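(* For every integer $d \geq 2$ and $\varepsilon \in (0,1)$, there is an $r=r(d,\varepsilon) \in \mathbb{N}$ such that for all positive integers $n$ and $m$ there is a set $P$ of $n$ points in $\mathbb{R}^d$ and an arrangement $\mathcal{H}$ of $m$ hyperplanes in $\mathbb{R}^d$ such that $K_{r,r} \not\subseteq G(P,\mathcal{H})$ and the number of incidences between $P$ and $\mathcal{H}$ satisfies \[\mathrm{inc}(P,\mathcal{H}) \geq \begin{cases} \Omega_{d,\varepsilon}\left((mn)^{1-(2d+3)/((d+2)(d+3)) - \varepsilon}\right) &\mbox{if } d \mbox{ is odd,} \\ \Omega_{d,\varepsilon}\left((mn)^{1-(2d^2+d-2)/((d+2)(d^2+2d-2)) -\varepsilon}\right) & \mbox{if } d \mbox{ is even.} \end{cases}\]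
   Context: An incidence between a point set $P$ and a hyperplane arrangement $\mathcal{H}$ is a pair $(p,H)$ with $p\in P$, $H\in\mathcal{H}$, $p\in H$; $\mathrm{inc}(P,\mathcal{H})$ denotes the number of incidences. $G(P,\mathcal{H})$ is the bipartite incidence graph on $P\cup\mathcal{H}$ with edges $\{p,H\}$ for incidences $(p,H)$. $\Omega_{d,\varepsilon}$ hides constants depending on $d,\varepsilon$. *)

theory Defs
  imports "HOL-Analysis.Analysis"
begin

definition is_hyperplane :: "(real ^ 'n) set \<Rightarrow> bool" where
  "is_hyperplane H \<longleftrightarrow> (\<exists>a b. a \<noteq> 0 \<and> H = {x. a \<bullet> x = b})"

definition inc :: "(real ^ 'n) set \<Rightarrow> (real ^ 'n) set set \<Rightarrow> nat" where
  "inc P Hs = card {(p, H). p \<in> P \<and> H \<in> Hs \<and> p \<in> H}"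

definition contains_Krr :: "nat \<Rightarrow> (real ^ 'n) set \<Rightarrow> (real ^ 'n) set set \<Rightarrow> bool" where
  "contains_Krr r P Hs \<longleftrightarrow> (\<exists>P' Hs'. P' \<subseteq> P \<and> Hs' \<subseteq> Hs \<and> card P' = r \<and> card Hs' = r
       \<and> (\<forall>p\<in>P'. \<forall>H\<in>Hs'. p \<in> H))"

definition inc_exponent :: "nat \<Rightarrow> real" where
  "inc_exponent d = (if odd d
      then 1 - (2 * real d + 3) / ((real d + 2) * (real d + 3))
      else 1 - (2 * (real d)^2 + real d - 2) / ((real d + 2) * ((real d)^2 + 2 * real d - 2)))"

end

theory Submission
  imports Defs "HOL-Number_Theory.Cong" "HOL-Real_Asymp.Real_Asymp"
begin

text \<open>
  Fix \<open>K + s = d\<close>. Modulo a prime \<open>p\<close>, a random set of about \<open>p ^ (s + 1)\<close> points of the grid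
  \<open>{0..<p} ^ d\<close> has the property that any \<open>r\<close> of them contain \<open>K + 1\<close> affinely independent
  ones. Modulo a second prime \<open>q\<close>, a random set of about \<open>q ^ K\<close> projective points has the
  property that any \<open>r\<close> of them contain \<open>s + 1\<close> linearly independent ones; rescaling modulo
  \<open>q\<close> makes their entries as small as \<open>q ^ ((d - 1) / d)\<close>, so that the hyperplanes with
  these normals through the points are few. Since independence modulo a prime implies independence over
  the integers, \<open>r\<close> points all lying on \<open>r\<close> of these hyperplanes would give orthogonal systems
  of total size \<open>d + 2\<close> in dimension \<open>d + 1\<close>. Optimising \<open>p\<close> and \<open>q\<close> gives the bound for
  \<open>m \<le> n\<close>, and duality the other case. As a factor \<open>(mn) powr - \<epsilon>\<close> may be lost, primes are
  only needed in intervals \<open>[x powr (1 - \<delta>), x]\<close>, where the central binomial coefficient provides them.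
\<close>

section \<open>Primes in long intervals\<close>

text \<open>The exponents come from a count. The affine hull of \<open>K\<close> points modulo
  \<open>p\<close> has at most \<open>p ^ (K - 1)\<close> of the \<open>p ^ d\<close> grid points, a
  fraction \<open>1 / p ^ (s + 1)\<close>; so about \<open>p ^ (s + 1)\<close> random points can be
  taken before many of them are likely to share such a hull. Dually, \<open>s\<close> normals span a
  fraction \<open>1 / q ^ K\<close> of the \<open>q ^ (d - 1)\<close> projective points. Every point
  lies on one hyperplane per normal, hence there are about \<open>p ^ (s + 1) * q ^ K\<close>
  incidences. A normal with entries up to \<open>q powr (1 - 1 / d)\<close> takes about
  \<open>p * q powr (1 - 1 / d)\<close> values on the grid, so there are about
  \<open>p * q powr \<beta>\<close> hyperplanes, with \<open>\<beta> = K + 1 - 1 / d\<close>.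
  Setting \<open>n = p ^ a\<close> with \<open>a = s + 1\<close> and
  \<open>m = p * q powr \<beta>\<close> turns the number of incidences into
  \<open>n powr (1 - K / (a * \<beta>)) * m powr (K / \<beta>)\<close>. For \<open>m \<le> n\<close>
  this is at least \<open>m * n\<close> raised to the mean of both exponents, provided the exponent
  of \<open>n\<close> is not the smaller one; \<open>K = d div 2\<close> ensures that.\<close>

lemma prime_power_dvd_lcmD:
  fixes a b p :: nat
  assumes "prime p" "a > 0" "b > 0" "p ^ e dvd lcm a b"
  shows "p ^ e dvd a \<or> p ^ e dvd b"
proof -
  have "multiplicity p (lcm a b) = max (multiplicity p a) (multiplicity p b)"
    using assms by (simp flip: count_prime_factorization_prime add: prime_factorization_lcm)
  moreover have "e \<le> multiplicity p (lcm a b)"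
    using assms by (subst (asm) power_dvd_iff_le_multiplicity) auto
  ultimately show ?thesis
    using multiplicity_dvd'[of e p a] multiplicity_dvd'[of e p b] by linarith
qed

text \<open>When one number is added, a prime power dividing the new lcm divides the old lcm or that
  number. The \<open>max 1\<close> takes care of \<open>n = 0\<close>, where the lcm is 1 and
  \<open>e\<close> may be 0.\<close>

lemma prime_power_dvd_Lcm_atLeastAtMostD:
  fixes p :: nat
  assumes "prime p" "p ^ e dvd Lcm {1..n}"
  shows "p ^ e \<le> max 1 n"
  using assms(2)
proof (induction n)
  case (Suc n)
  have "Lcm {1..Suc n} = lcm (Suc n) (Lcm {1..n})"
    by (simp add: atLeastAtMostSuc_conv)
  moreover have "Lcm {1..n} > 0"
    by (rule Nat.gr0I) (auto simp: Lcm_0_iff)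
  ultimately have "p ^ e dvd Suc n \<or> p ^ e dvd Lcm {1..n}"
    using Suc.prems prime_power_dvd_lcmD[OF assms(1)] by simp
  thus ?case
    using Suc.IH dvd_imp_le[of "p ^ e" "Suc n"] by (auto simp: max_def split: if_splits)
qed auto

text \<open>In Leibniz' harmonic triangle every entry is a difference of two entries with smaller \<open>k\<close>,
  so a common denominator for the column \<open>k = 0\<close> is one for all entries.\<close>
lemma harmonic_triangle:
  assumes "k < n"
  shows "1 / (real (n + 1) * real (n choose Suc k)) =
         1 / (real n * real ((n - 1) choose k)) - 1 / (real (n + 1) * real (n choose k))"
proof -
  obtain m where n: "n = Suc m" using assms by (cases n) auto
  have km: "k \<le> m" using assms n by simp
  define x where "x = real (m choose k)"
  have x: "x > 0" using km by (simp add: x_def)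
  have s1: "real (Suc k) * real (n choose Suc k) = real n * x"
    unfolding n x_def using Suc_times_binomial_eq[of m k] by (metis mult.commute of_nat_mult)
  have "real (n - k) * real (n choose k) = real n * x"
  proof -
    have "(n - k) * (n choose k) = n * (m choose k)"
      using binomial_absorb_comp[of n k] n by simp
    thus ?thesis unfolding x_def by (metis of_nat_mult)
  qed
  moreover have "real (n - k) = real n - real k" using assms by simp
  ultimately have s2: "(real n - real k) * real (n choose k) = real n * x" by simp
  have e1: "real (n choose Suc k) = real n * x / (real k + 1)"
    using s1 by (simp add: field_simps)
  have e2: "real (n choose k) = real n * x / (real n - real k)"
    using s2 assms by (simp add: field_simps)
  have "n - 1 = m" using n by simp
  hence e3: "real ((n - 1) choose k) = x" by (simp add: x_def)
  have "real n > 0" "real n - real k > 0" using n assms by auto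
  thus ?thesis unfolding e1 e2 e3 using x by (simp add: divide_simps)
qed

text \<open>\<open>N\<close> stays fixed while \<open>n\<close> is generalised, because the triangle
  recursion also uses row \<open>n - 1\<close>.\<close>

lemma Suc_mult_choose_dvd_Lcm:
  assumes "k \<le> n" "n < N"
  shows "(n + 1) * (n choose k) dvd Lcm {1..N}"
proof -
  \<comment> \<open>Divisibility is recast as integrality of a real quotient, so that the recursion
    for unit fractions applies directly.\<close>
  have *: "\<exists>z::int. real (Lcm {1..N}) / (real (n + 1) * real (n choose k)) = of_int z"
    using assms
  proof (induction k arbitrary: n)
    case 0
    hence "(n + 1) dvd Lcm {1..N}" by (intro dvd_Lcm) auto
    then obtain z where "Lcm {1..N} = (n + 1) * z" by (elim dvdE)
    thus ?case by (intro exI[of _ "int z"]) (simp add: field_simps)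
  next
    case (Suc k)
    from Suc.IH[of n] obtain y where y:
      "real (Lcm {1..N}) / (real (n + 1) * real (n choose k)) = of_int y" using Suc.prems by auto
    have "n - 1 + 1 = n" using Suc.prems by simp
    with Suc.IH[of "n - 1"] Suc.prems obtain z where z:
      "real (Lcm {1..N}) / (real n * real ((n - 1) choose k)) = of_int z"
      by (metis Suc_eq_plus1 Suc_le_mono less_imp_diff_less)
    have "real (Lcm {1..N}) * (1 / (real (n + 1) * real (n choose Suc k))) = of_int z - of_int y"
      unfolding y[symmetric] z[symmetric] using harmonic_triangle[of k n] Suc.prems
      by (simp only: right_diff_distrib) simp
    thus ?case by (intro exI[of _ "z - y"]) simp
  qed
  then obtain z :: int where "real (Lcm {1..N}) / (real (n + 1) * real (n choose k)) = of_int z" by blast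
  moreover have "real (n + 1) * real (n choose k) \<noteq> 0" using assms by simp
  ultimately have "real (Lcm {1..N}) = of_int z * (real (n + 1) * real (n choose k))"
    by (metis nonzero_divide_eq_eq)
  hence "real_of_int (int (Lcm {1..N})) = real_of_int (z * (int (n + 1) * int (n choose k)))" by simp
  hence "int (Lcm {1..N}) = int ((n + 1) * (n choose k)) * z"
    by (simp only: of_int_eq_iff of_nat_mult mult.commute)
  thus ?thesis by (metis dvd_triv_left int_dvd_int_iff)
qed

text \<open>A weak form of what Kummer's theorem gives, obtained without counting carries: the
  binomial coefficient divides the lcm of the numbers up to \<open>n + 1\<close>, whose prime powers
  are at most \<open>n + 1\<close>.\<close>

lemma prime_power_dvd_choose_le:
  fixes p :: nat
  assumes "prime p" "k \<le> n" "p ^ e dvd n choose k"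
  shows "p ^ e \<le> n + 1"
proof -
  have "p ^ e dvd (n + 1) * (n choose k)" using assms by simp
  also have "\<dots> dvd Lcm {1..n + 1}" by (rule Suc_mult_choose_dvd_Lcm) (use assms in auto)
  finally show ?thesis using prime_power_dvd_Lcm_atLeastAtMostD[OF assms(1)] by fastforce
qed

text \<open>Each prime of the factorization contributes at most \<open>2 * n + 1\<close>, so a large
  central coefficient forces many primes.\<close>

lemma central_choose_le:
  "real (2 * n choose n) \<le> real (2 * n + 1) ^ card {p. prime p \<and> p \<le> 2 * n + 1}"
proof -
  let ?c = "2 * n choose n" and ?A = "{p. prime p \<and> p \<le> 2 * n + 1}"
  have c: "?c > 0" by simp
  have m: "p ^ multiplicity p ?c \<le> 2 * n + 1" if "p \<in> prime_factors ?c" for p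
    by (rule prime_power_dvd_choose_le[of p n "2 * n"]) (use that in \<open>auto simp: multiplicity_dvd\<close>)
  have sub: "prime_factors ?c \<subseteq> ?A"
  proof safe
    fix p assume p: "p \<in> prime_factors ?c"
    show "prime p" using p by auto
    have "p ^ 1 \<le> 2 * n + 1"
      by (rule prime_power_dvd_choose_le[of p n "2 * n"]) (use p in auto)
    thus "p \<le> 2 * n + 1" by simp
  qed
  have "?c = (\<Prod>p\<in>prime_factors ?c. p ^ multiplicity p ?c)"
    using prime_factorization_nat c by blast
  also have "\<dots> \<le> (\<Prod>p\<in>prime_factors ?c. 2 * n + 1)"
    by (rule prod_mono) (use m in auto)
  also have "\<dots> = (2 * n + 1) ^ card (prime_factors ?c)" by simp
  also have "\<dots> \<le> (2 * n + 1) ^ card ?A"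
    by (intro power_increasing card_mono sub) auto
  finally show ?thesis by (metis of_nat_le_iff of_nat_power)
qed

lemma exists_prime_between:
  fixes \<delta> :: real
  assumes "0 < \<delta>" "\<delta> < 1"
  obtains x0 where "x0 \<ge> 1" "\<And>x::real. x \<ge> x0 \<Longrightarrow> \<exists>p::nat. prime p \<and> x powr (1 - \<delta>) \<le> real p \<and> real p \<le> x"
proof -
  \<comment> \<open>On the left is a lower bound for the logarithm of a central coefficient; on the
    right, an upper bound for it if all primes up to \<open>x\<close> were below
    \<open>x powr (1 - \<delta>)\<close>.\<close>
  have "\<forall>\<^sub>F x::real in at_top. (x/2 - 2) * ln 4 - ln x > (x powr (1 - \<delta>) + 1) * ln (x + 1)"
    using assms by real_asymp
  then obtain x1 where x1:
    "\<And>x. x \<ge> x1 \<Longrightarrow> (x/2 - 2) * ln 4 - ln x > (x powr (1 - \<delta>) + 1) * ln (x + 1)"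
    by (auto simp: eventually_at_top_linorder)
  show ?thesis
  proof (rule that[of "max x1 10"])
    fix x :: real assume "x \<ge> max x1 10"
    hence x: "x \<ge> x1" "x \<ge> 10" by auto
    show "\<exists>p::nat. prime p \<and> x powr (1 - \<delta>) \<le> real p \<and> real p \<le> x"
    proof (rule ccontr)
      assume neg: "\<not> ?thesis"
      \<comment> \<open>The largest \<open>n\<close> with \<open>2 * n + 1 \<le> x\<close>, so that
        the primes counted do not exceed \<open>x\<close>.\<close>
      define n where "n = nat \<lfloor>(x - 1) / 2\<rfloor>"
      have "real n = of_int \<lfloor>(x - 1) / 2\<rfloor>" unfolding n_def using x by simp
      hence n: "real n \<le> (x - 1) / 2" "real n > (x - 1) / 2 - 1" by linarith+
      have n0: "n > 0" using n x by (intro Nat.gr0I) auto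
      let ?A = "{p::nat. prime p \<and> p \<le> 2 * n + 1}"
      have "?A \<subseteq> {..nat \<lfloor>x powr (1 - \<delta>)\<rfloor>}"
      proof safe
        fix p assume p: "prime p" "p \<le> 2 * n + 1"
        have "real p \<le> real (2 * n + 1)" using p by (simp only: of_nat_le_iff)
        hence "real p \<le> x" using n by simp
        hence "real p < x powr (1 - \<delta>)" using neg p(1) by (meson not_le)
        thus "p \<le> nat \<lfloor>x powr (1 - \<delta>)\<rfloor>" by (simp add: le_nat_floor)
      qed
      hence "card ?A \<le> card {..nat \<lfloor>x powr (1 - \<delta>)\<rfloor>}" by (rule card_mono[rotated]) auto
      hence A: "real (card ?A) \<le> x powr (1 - \<delta>) + 1"
        by (simp add: le_nat_iff) (use powr_ge_zero[of x "1 - \<delta>"] in linarith)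
      have "4 ^ n / (2 * real n) \<le> real (2 * n + 1) ^ card ?A"
        using central_binomial_lower_bound[OF n0] central_choose_le[of n] by linarith
      hence "ln (4 ^ n / (2 * real n)) \<le> ln (real (2 * n + 1) ^ card ?A)"
        using n0 by (subst ln_le_cancel_iff) auto
      also have "ln (4 ^ n / (2 * real n)) = real n * ln 4 - ln (2 * real n)"
        using n0 by (subst ln_div) (auto simp: ln_realpow)
      also have "ln (real (2 * n + 1) ^ card ?A) = card ?A * ln (real (2 * n + 1))"
        by (simp add: ln_realpow)
      also have "\<dots> \<le> (x powr (1 - \<delta>) + 1) * ln (x + 1)"
        by (intro mult_mono A) (use n x in auto)
      finally have "real n * ln 4 - ln (2 * real n) \<le> (x powr (1 - \<delta>) + 1) * ln (x + 1)" .
      moreover have "ln (2 * real n) \<le> ln x" using n n0 by (subst ln_le_cancel_iff) auto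
      moreover have "(x/2 - 2) * ln 4 \<le> real n * ln 4" by (intro mult_right_mono) (use n in \<open>simp_all add: field_simps\<close>)
      ultimately show False using x1[OF x(1)] by linarith
    qed
  qed auto
qed

section \<open>Sets with independent subsets modulo a prime\<close>

text \<open>Union bound: the \<open>T\<close>-tuples over \<open>V\<close> violating the conclusion along a fixed injection
  \<open>\<iota>\<close> make up at most a fraction \<open>(M / card V) ^ (r - s)\<close> of all tuples.\<close>
lemma random_set:
  fixes V :: "'a set" and cl :: "(nat \<Rightarrow> 'a) \<Rightarrow> 'a set"
  assumes V: "finite V" "V \<noteq> {}"
    and cong: "\<And>g h. (\<And>j. j < s \<Longrightarrow> g j = h j) \<Longrightarrow> cl g = cl h"
    and M: "\<And>g. (\<And>j. j < s \<Longrightarrow> g j \<in> V) \<Longrightarrow> card (cl g \<inter> V) \<le> M"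
    and base: "\<And>g j. (\<And>j. j < s \<Longrightarrow> g j \<in> V) \<Longrightarrow> j < s \<Longrightarrow> g j \<in> cl g"
    and s: "0 < s" "s \<le> r"
    and lt: "T ^ r * M ^ (r - s) < card V ^ (r - s)"
  shows "\<exists>S\<subseteq>V. T \<le> r * card S \<and> card S \<le> T \<and>
           (\<forall>g. inj_on g {..<r} \<and> g ` {..<r} \<subseteq> S \<longrightarrow> (\<exists>t\<in>{s..<r}. g t \<notin> cl g))"
proof -
  define F where "F = {..<T} \<rightarrow>\<^sub>E V"
  define I where "I = {\<iota> \<in> {..<r} \<rightarrow>\<^sub>E {..<T}. inj_on \<iota> {..<r}}"
  define Bad where "Bad = (\<lambda>\<iota>. {f \<in> F. \<forall>t\<in>{s..<r}. f (\<iota> t) \<in> cl (f \<circ> \<iota>)})"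
  have finF: "finite F" unfolding F_def using V by (intro finite_PiE) auto
  have cardF: "card F = card V ^ T" unfolding F_def by (simp add: card_PiE)
  have finI: "finite I" unfolding I_def
    by (rule finite_subset[OF _ finite_PiE[of "{..<r}" "\<lambda>_. {..<T}"]]) auto
  have "card I \<le> card ({..<r} \<rightarrow>\<^sub>E {..<T})"
    unfolding I_def by (rule card_mono) (auto intro!: finite_PiE)
  hence cardI: "card I \<le> T ^ r" by (simp add: card_PiE)
  have Vpos: "card V > 0" using V by (simp add: card_gt_0_iff)
  have bad: "card (Bad \<iota>) * card V ^ (r - s) \<le> card V ^ T * M ^ (r - s)" if \<iota>: "\<iota> \<in> I" for \<iota>
  proof -
    define R where "R = \<iota> ` {s..<r}"
    have inj: "inj_on \<iota> {..<r}" and into: "\<iota> ` {..<r} \<subseteq> {..<T}" using \<iota> by (auto simp: I_def)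
    have "inj_on \<iota> {s..<r}" by (rule inj_on_subset[OF inj]) auto
    hence cR: "card R = r - s" unfolding R_def by (simp add: card_image)
    have RT: "R \<subseteq> {..<T}" unfolding R_def by (rule subset_trans[OF image_mono into]) auto
    have rT: "r - s \<le> T" using card_mono[OF _ RT] cR by simp
    \<comment> \<open>A bad \<open>f\<close> is encoded by its values off \<open>R\<close> and its
      \<open>r - s\<close> values on \<open>R\<close>. The first part contains the first
      \<open>s\<close> entries along \<open>\<iota>\<close> and hence fixes the closure; each entry
      of the second part then has at most \<open>M\<close> choices.\<close>
    define Sg where "Sg = Sigma (({..<T} - R) \<rightarrow>\<^sub>E V) (\<lambda>h. {s..<r} \<rightarrow>\<^sub>E (cl (h \<circ> \<iota>) \<inter> V))"
    define \<Phi> where "\<Phi> = (\<lambda>f::nat \<Rightarrow> 'a. (restrict f ({..<T} - R), restrict (f \<circ> \<iota>) {s..<r}))"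
    have low: "\<iota> j \<in> {..<T} - R" if "j < s" for j
    proof -
      have "j < r" using that s by simp
      have "\<iota> j \<notin> R"
      proof
        assume "\<iota> j \<in> R"
        then obtain t where t: "t \<in> {s..<r}" "\<iota> j = \<iota> t" unfolding R_def by auto
        hence "j = t" using inj_onD[OF inj t(2)] \<open>j < r\<close> by auto
        thus False using t that by auto
      qed
      thus ?thesis using into \<open>j < r\<close> by auto
    qed
    have finSg: "finite Sg" unfolding Sg_def using V by (intro finite_SigmaI finite_PiE) auto
    have "inj_on \<Phi> (Bad \<iota>)"
    proof (rule inj_onI)
      fix f g assume f: "f \<in> Bad \<iota>" and g: "g \<in> Bad \<iota>" and eq: "\<Phi> f = \<Phi> g"
      show "f = g"
      proof
        fix i
        consider "i \<notin> {..<T}" | "i \<in> {..<T} - R" | t where "t \<in> {s..<r}" "i = \<iota> t"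
          unfolding R_def by blast
        thus "f i = g i"
        proof cases
          case 1
          thus ?thesis using f g unfolding Bad_def F_def by (auto simp: PiE_def extensional_def)
        next
          case 2
          have "restrict f ({..<T} - R) i = restrict g ({..<T} - R) i" using eq by (simp add: \<Phi>_def)
          thus ?thesis using 2 by simp
        next
          case 3
          have "restrict (f \<circ> \<iota>) {s..<r} t = restrict (g \<circ> \<iota>) {s..<r} t" using eq by (simp add: \<Phi>_def)
          thus ?thesis using 3 by simp
        qed
      qed
    qed
    moreover have "\<Phi> ` Bad \<iota> \<subseteq> Sg"
    proof
      fix y assume "y \<in> \<Phi> ` Bad \<iota>"
      then obtain f where f: "f \<in> Bad \<iota>" "y = \<Phi> f" by auto
      have fV: "f i \<in> V" if "i < T" for i using f that by (auto simp: Bad_def F_def PiE_def)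
      have "cl (restrict f ({..<T} - R) \<circ> \<iota>) = cl (f \<circ> \<iota>)"
        by (rule cong) (use low in auto)
      moreover have "f (\<iota> t) \<in> cl (f \<circ> \<iota>) \<inter> V" if "t \<in> {s..<r}" for t
        using f fV[of "\<iota> t"] into that by (auto simp: Bad_def)
      ultimately show "y \<in> Sg" unfolding f(2) \<Phi>_def Sg_def using fV by auto
    qed
    ultimately have "card (Bad \<iota>) \<le> card Sg" by (metis card_inj_on_le finSg)
    also have "card Sg = (\<Sum>h\<in>({..<T} - R) \<rightarrow>\<^sub>E V. card (cl (h \<circ> \<iota>) \<inter> V) ^ (r - s))"
      unfolding Sg_def using V by (subst card_SigmaI) (auto intro!: finite_PiE simp: card_PiE)
    also have "\<dots> \<le> (\<Sum>h\<in>({..<T} - R) \<rightarrow>\<^sub>E V. M ^ (r - s))"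
    proof (intro sum_mono power_mono M)
      fix h j assume "h \<in> ({..<T} - R) \<rightarrow>\<^sub>E V" "j < s"
      thus "(h \<circ> \<iota>) j \<in> V" using low[of j] by (auto simp: PiE_def Pi_def)
    qed auto
    also have "\<dots> = card V ^ (T - (r - s)) * M ^ (r - s)"
      using cR RT by (simp add: card_PiE card_Diff_subset finite_subset)
    finally have "card (Bad \<iota>) * card V ^ (r - s) \<le> card V ^ (T - (r - s)) * M ^ (r - s) * card V ^ (r - s)"
      by (rule mult_right_mono) simp
    also have "\<dots> = card V ^ T * M ^ (r - s)"
      using rT by (metis le_add_diff_inverse2 mult.assoc mult.commute power_add)
    finally show ?thesis .
  qed
  have "card (\<Union>\<iota>\<in>I. Bad \<iota>) * card V ^ (r - s) \<le> (\<Sum>\<iota>\<in>I. card (Bad \<iota>)) * card V ^ (r - s)"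
    by (intro mult_right_mono card_UN_le finI) auto
  also have "\<dots> = (\<Sum>\<iota>\<in>I. card (Bad \<iota>) * card V ^ (r - s))" by (simp add: sum_distrib_right)
  also have "\<dots> \<le> (\<Sum>\<iota>\<in>I. card V ^ T * M ^ (r - s))" by (intro sum_mono bad)
  also have "\<dots> = card I * (card V ^ T * M ^ (r - s))" by simp
  also have "\<dots> \<le> T ^ r * (card V ^ T * M ^ (r - s))" by (intro mult_right_mono cardI) auto
  also have "\<dots> = card V ^ T * (T ^ r * M ^ (r - s))" by (simp add: mult_ac)
  also have "\<dots> < card V ^ T * card V ^ (r - s)" by (intro mult_strict_left_mono lt) (use Vpos in auto)
  finally have "card (\<Union>\<iota>\<in>I. Bad \<iota>) < card F" using cardF by simp
  hence "\<not> F \<subseteq> (\<Union>\<iota>\<in>I. Bad \<iota>)"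
    using card_mono[of "\<Union>\<iota>\<in>I. Bad \<iota>" F] finI finF by (auto simp: Bad_def)
  then obtain f where f: "f \<in> F" "\<And>\<iota>. \<iota> \<in> I \<Longrightarrow> f \<notin> Bad \<iota>" by blast
  have fV: "f i \<in> V" if "i < T" for i using f that by (auto simp: F_def PiE_def)
  have key: "\<exists>t\<in>{s..<r}. f (\<iota> t) \<notin> cl (f \<circ> \<iota>)"
    if "inj_on \<iota> {..<r}" "\<iota> ` {..<r} \<subseteq> {..<T}" for \<iota>
  proof -
    have eq: "cl (f \<circ> restrict \<iota> {..<r}) = cl (f \<circ> \<iota>)" by (rule cong) (use s in auto)
    have "restrict \<iota> {..<r} \<in> I" using that by (auto simp: I_def inj_on_def)
    hence "f \<notin> Bad (restrict \<iota> {..<r})" by (rule f)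
    thus ?thesis using f(1) eq unfolding Bad_def by auto
  qed
  define S where "S = f ` {..<T}"
  \<comment> \<open>The tuple \<open>f\<close> need not be injective. If \<open>r\<close> positions
    carried the same value \<open>y\<close>, the closure of the first \<open>s\<close> of them would
    contain \<open>y\<close> by \<open>base\<close>, and so all later entries, which
    \<open>key\<close> rules out.\<close>
  have fib: "card {i\<in>{..<T}. f i = y} \<le> r" for y
  proof (rule ccontr)
    assume "\<not> ?thesis"
    hence "card {..<r} \<le> card {i\<in>{..<T}. f i = y}" by simp
    then obtain \<iota> where \<iota>: "inj_on \<iota> {..<r}" "\<iota> ` {..<r} \<subseteq> {i\<in>{..<T}. f i = y}"
      using card_le_inj[of "{..<r}" "{i\<in>{..<T}. f i = y}"] by auto
    hence eq: "f (\<iota> t) = y" and lt: "\<iota> t < T" if "t < r" for t using that by auto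
    have "\<iota> ` {..<r} \<subseteq> {..<T}" using \<iota>(2) by (rule subset_trans) auto
    then obtain t where t: "t \<in> {s..<r}" "f (\<iota> t) \<notin> cl (f \<circ> \<iota>)" using key[OF \<iota>(1)] by blast
    have "(f \<circ> \<iota>) 0 \<in> cl (f \<circ> \<iota>)"
      by (rule base) (use s fV lt in auto)
    thus False using eq[of 0] eq[of t] t s by auto
  qed
  have "{..<T} = (\<Union>y\<in>S. {i\<in>{..<T}. f i = y})" by (auto simp: S_def)
  hence "T = card (\<Union>y\<in>S. {i\<in>{..<T}. f i = y})" by (metis card_lessThan)
  also have "\<dots> \<le> (\<Sum>y\<in>S. card {i\<in>{..<T}. f i = y})"
    by (rule card_UN_le) (simp add: S_def)
  also have "\<dots> \<le> (\<Sum>y\<in>S. r)" by (intro sum_mono fib)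
  finally have 1: "T \<le> r * card S" by (simp add: mult.commute)
  have 2: "card S \<le> T" unfolding S_def using card_image_le[of "{..<T}" f] by simp
  have 3: "\<exists>t\<in>{s..<r}. g t \<notin> cl g" if g: "inj_on g {..<r}" "g ` {..<r} \<subseteq> S" for g
  proof -
    have "\<forall>t. \<exists>i. t < r \<longrightarrow> i < T \<and> f i = g t" using g by (force simp: S_def)
    then obtain \<iota> where \<iota>: "\<And>t. t < r \<Longrightarrow> \<iota> t < T \<and> f (\<iota> t) = g t" by metis
    have "inj_on \<iota> {..<r}" using g(1) \<iota> by (metis inj_onI inj_on_def lessThan_iff)
    moreover have "\<iota> ` {..<r} \<subseteq> {..<T}" using \<iota> by auto
    ultimately obtain t where t: "t \<in> {s..<r}" "f (\<iota> t) \<notin> cl (f \<circ> \<iota>)" using key by blast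
    have "cl (f \<circ> \<iota>) = cl g" by (rule cong) (use \<iota> s in auto)
    thus ?thesis using t \<iota> by force
  qed
  have "S \<subseteq> V" using fV by (auto simp: S_def)
  with 1 2 3 show ?thesis by blast
qed

text \<open>For \<open>p = 0\<close> this is linear independence over the integers.\<close>
definition indep_mod :: "int \<Rightarrow> 'b set \<Rightarrow> ('b \<Rightarrow> 'i \<Rightarrow> int) \<Rightarrow> bool" where
  "indep_mod p B f \<longleftrightarrow> (\<forall>c. (\<forall>i. p dvd (\<Sum>b\<in>B. c b * f b i)) \<longrightarrow> (\<forall>b\<in>B. p dvd c b))"

lemma indep_mod_subset:
  assumes "indep_mod p B f" "A \<subseteq> B" "finite B"
  shows "indep_mod p A f"
  unfolding indep_mod_def
proof (intro allI impI)
  fix c assume c: "\<forall>i. p dvd (\<Sum>b\<in>A. c b * f b i)"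
  define c' where "c' = (\<lambda>b. if b \<in> A then c b else 0)"
  have "(\<Sum>b\<in>B. c' b * f b i) = (\<Sum>b\<in>A. c b * f b i)" for i
    by (rule sum.mono_neutral_cong_right) (use assms in \<open>auto simp: c'_def\<close>)
  hence "\<forall>b\<in>B. p dvd c' b" using assms(1) c unfolding indep_mod_def by metis
  moreover have "c' b = c b" if "b \<in> A" for b using that by (simp add: c'_def)
  ultimately show "\<forall>b\<in>A. p dvd c b" using assms(2) by (metis subsetD)
qed

text \<open>Coefficients are residues, which leaves finitely many choices to count; only the first
  \<open>s\<close> vectors matter, as \<open>random_set\<close> demands of its closure.\<close>

definition mod_span :: "int \<Rightarrow> nat \<Rightarrow> (nat \<Rightarrow> 'i \<Rightarrow> int) \<Rightarrow> ('i \<Rightarrow> int) set" where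
  "mod_span p s g = {x. \<exists>e. (\<forall>j<s. e j \<in> {0..<p}) \<and> (\<forall>i. [x i = (\<Sum>j<s. e j * g j i)] (mod p))}"

text \<open>The coordinate \<open>i0\<close> serves as homogenising coordinate for points of the lattice and
  makes normal vectors pairwise non-parallel modulo \<open>p\<close>.\<close>
definition affine_box :: "int \<Rightarrow> 'i \<Rightarrow> ('i \<Rightarrow> int) set" where
  "affine_box p i0 = {v. v i0 = 1 \<and> (\<forall>i. v i \<in> {0..<p})}"


lemma
  fixes i0 :: "'i::finite"
  assumes "p > 1"
  shows finite_affine_box: "finite (affine_box (int p) i0)"
    and card_affine_box: "card (affine_box (int p) i0) = p ^ (CARD('i) - 1)"
proof -
  have eq: "affine_box (int p) i0 = (\<Pi>\<^sub>E i\<in>UNIV. if i = i0 then {1} else {0..<int p})"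
  proof (rule equalityI; rule subsetI)
    fix v assume "v \<in> affine_box (int p) i0"
    thus "v \<in> (\<Pi>\<^sub>E i\<in>UNIV. if i = i0 then {1} else {0..<int p})"
      by (simp add: affine_box_def PiE_iff)
  next
    fix v assume "v \<in> (\<Pi>\<^sub>E i\<in>UNIV. if i = i0 then {1} else {0..<int p})"
    hence "v i \<in> (if i = i0 then {1} else {0..<int p})" for i by (simp add: PiE_iff)
    thus "v \<in> affine_box (int p) i0"
      using assms unfolding affine_box_def mem_Collect_eq
      by (metis atLeastLessThan_iff of_nat_1 of_nat_less_iff singletonD zero_le_one)
  qed
  show "finite (affine_box (int p) i0)" unfolding eq by (intro finite_PiE) auto
  have "card (affine_box (int p) i0) = (\<Prod>i\<in>UNIV. card (if i = i0 then {1} else {0..<int p}))"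
    unfolding eq by (rule card_PiE) auto
  also have "\<dots> = (\<Prod>i\<in>UNIV - {i0}. card (if i = i0 then {1} else {0..<int p}))"
    by (subst prod.remove[of UNIV i0]) auto
  also have "\<dots> = (\<Prod>i\<in>UNIV - {i0}. p)" by (intro prod.cong) auto
  also have "\<dots> = p ^ (CARD('i) - 1)" by simp
  finally show "card (affine_box (int p) i0) = p ^ (CARD('i) - 1)" .
qed

lemma cong_imp_eq_atLeastLessThan:
  fixes a b p :: int
  assumes "[a = b] (mod p)" "a \<in> {0..<p}" "b \<in> {0..<p}"
  shows "a = b"
  using assms unfolding Cong.cong_def by simp

text \<open>Coefficients expressing a point of the box by points of the box sum up to 1 modulo \<open>p\<close>,
  so one of them is redundant.\<close>
lemma card_mod_span_le:
  fixes i0 :: "'i::finite"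
  assumes p: "p > 1" and s: "s > 0" and g: "\<And>j. j < s \<Longrightarrow> g j \<in> affine_box (int p) i0"
  shows "card (mod_span (int p) s g \<inter> affine_box (int p) i0) \<le> p ^ (s - 1)"
proof -
  let ?X = "mod_span (int p) s g \<inter> affine_box (int p) i0"
  have "\<forall>x. \<exists>e. x \<in> ?X \<longrightarrow> (\<forall>j<s. e j \<in> {0..<int p}) \<and> (\<forall>i. [x i = (\<Sum>j<s. e j * g j i)] (mod (int p)))"
    by (auto simp: mod_span_def)
  then obtain E where E: "\<And>x j. x \<in> ?X \<Longrightarrow> j < s \<Longrightarrow> E x j \<in> {0..<int p}"
    "\<And>x i. x \<in> ?X \<Longrightarrow> [x i = (\<Sum>j<s. E x j * g j i)] (mod (int p))" by metis
  \<comment> \<open>Coefficient 0 is the one dropped; reading coordinate \<open>i0\<close> recovers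
    it from the others.\<close>
  have "inj_on (\<lambda>x. restrict (E x) {1..<s}) ?X"
  proof (rule inj_onI)
    fix x y assume x: "x \<in> ?X" and y: "y \<in> ?X" and eq: "restrict (E x) {1..<s} = restrict (E y) {1..<s}"
    have eq1: "E x j = E y j" if "j \<in> {1..<s}" for j
      using fun_cong[OF eq, of j] that by simp
    have split: "(\<Sum>j<s. f j) = f 0 + (\<Sum>j\<in>{1..<s}. f j)" for f :: "nat \<Rightarrow> int"
      using s by (simp add: lessThan_atLeast0 sum.atLeast_Suc_lessThan)
    have sum1: "[E z 0 + (\<Sum>j\<in>{1..<s}. E z j) = 1] (mod (int p))" if "z \<in> ?X" for z
    proof -
      have "[z i0 = (\<Sum>j<s. E z j * g j i0)] (mod (int p))" by (rule E(2)[OF that])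
      also have "(\<Sum>j<s. E z j * g j i0) = (\<Sum>j<s. E z j)"
        using g by (intro sum.cong) (auto simp: affine_box_def)
      finally show ?thesis using that split[of "E z"] by (simp add: affine_box_def cong_sym_eq)
    qed
    have "(\<Sum>j\<in>{1..<s}. E x j) = (\<Sum>j\<in>{1..<s}. E y j)" by (intro sum.cong eq1) auto
    hence "[E x 0 + (\<Sum>j\<in>{1..<s}. E y j) = E y 0 + (\<Sum>j\<in>{1..<s}. E y j)] (mod (int p))"
      using cong_trans[OF sum1[OF x] cong_sym[OF sum1[OF y]]] by simp
    hence "[E x 0 = E y 0] (mod (int p))" by (simp only: cong_add_rcancel)
    hence "E x 0 = E y 0" using E(1)[OF x s] E(1)[OF y s] by (rule cong_imp_eq_atLeastLessThan)
    hence eq2: "E x j = E y j" if "j < s" for j using eq1[of j] that by (cases "j = 0") auto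
    show "x = y"
    proof
      fix i
      have "(\<Sum>j<s. E x j * g j i) = (\<Sum>j<s. E y j * g j i)" by (intro sum.cong) (auto simp: eq2)
      hence "[x i = y i] (mod (int p))"
        using cong_trans[OF E(2)[OF x, of i]] cong_sym[OF E(2)[OF y, of i]] by simp
      thus "x i = y i" using x y by (intro cong_imp_eq_atLeastLessThan) (auto simp: affine_box_def)
    qed
  qed
  moreover have "(\<lambda>x. restrict (E x) {1..<s}) ` ?X \<subseteq> {1..<s} \<rightarrow>\<^sub>E {0..<int p}"
    using E(1) by auto
  ultimately have "card ?X \<le> card ({1..<s} \<rightarrow>\<^sub>E {0..<int p})"
    by (intro card_inj_on_le[of "\<lambda>x. restrict (E x) {1..<s}"]) (auto intro!: finite_PiE)
  also have "\<dots> = p ^ (s - 1)" by (simp add: card_PiE)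
  finally show ?thesis .
qed

text \<open>\<open>random_set\<close> speaks about the first \<open>s\<close> entries of an
  enumeration, so the enumeration has to start with a maximal independent subset.\<close>

lemma ex_enum_extending:
  assumes "finite A" "B \<subseteq> A"
  obtains g :: "nat \<Rightarrow> 'a" where "bij_betw g {..<card A} A" "bij_betw g {..<card B} B"
proof -
  have B: "finite B" using assms finite_subset by blast
  obtain h1 where h1: "bij_betw h1 {..<card B} B"
    using ex_bij_betw_nat_finite[OF B] by (auto simp: lessThan_atLeast0)
  have le: "card B \<le> card A" using assms by (simp add: card_mono)
  have "card {card B..<card A} = card (A - B)" using assms B by (simp add: card_Diff_subset)
  then obtain h2 where h2: "bij_betw h2 {card B..<card A} (A - B)"
    using finite_same_card_bij[of "{card B..<card A}" "A - B"] assms by auto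
  define g where "g = (\<lambda>t. if t \<in> {..<card B} then h1 t else h2 t)"
  have 1: "bij_betw g {..<card B} B"
    using h1 by (rule bij_betw_cong[THEN iffD1, rotated]) (auto simp: g_def)
  have "bij_betw g {card B..<card A} (A - B)"
    using h2 by (rule bij_betw_cong[THEN iffD1, rotated]) (auto simp: g_def)
  hence "bij_betw g ({..<card B} \<union> {card B..<card A}) (B \<union> (A - B))"
    by (intro bij_betw_combine 1) auto
  moreover have "{..<card B} \<union> {card B..<card A} = {..<card A}" using le by auto
  moreover have "B \<union> (A - B) = A" using assms by auto
  ultimately show ?thesis using that 1 by metis
qed

text \<open>In a dependency the coefficient of \<open>x\<close> cannot vanish modulo
  \<open>p\<close>, because \<open>B\<close> is independent; as \<open>p\<close> is prime, it can be
  inverted.\<close>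

lemma dependent_imp_mod_combination:
  fixes B :: "('i \<Rightarrow> int) set"
  assumes p: "prime p" and B: "finite B" "indep_mod (int p) B (\<lambda>v. v)"
    and x: "x \<notin> B" "\<not> indep_mod (int p) (insert x B) (\<lambda>v. v)"
  obtains e where "\<And>i. [x i = (\<Sum>b\<in>B. e b * b i)] (mod (int p))"
proof -
  from x(2) obtain c where c: "\<And>i. int p dvd (\<Sum>b\<in>insert x B. c b * b i)"
    and nd: "\<exists>b\<in>insert x B. \<not> int p dvd c b" unfolding indep_mod_def by blast
  have c': "int p dvd c x * x i + (\<Sum>b\<in>B. c b * b i)" for i
    using c[of i] x(1) B by simp
  have cx: "\<not> int p dvd c x"
  proof
    assume *: "int p dvd c x"
    have "int p dvd (\<Sum>b\<in>B. c b * b i)" for i using c'[of i] * by (simp add: dvd_add_right_iff)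
    hence "\<forall>b\<in>B. int p dvd c b" using B(2) unfolding indep_mod_def by blast
    thus False using nd * by auto
  qed
  have "prime (int p)" using p by simp
  hence "coprime (int p) (c x)" using cx by (rule prime_imp_coprime)
  hence "coprime (c x) (int p)" by (simp add: coprime_commute)
  then obtain u where u: "[c x * u = 1] (mod (int p))" using cong_solve_coprime_int by blast
  show ?thesis
  proof (rule that[of "\<lambda>b. - u * c b"])
    fix i
    have "int p dvd u * (c x * x i + (\<Sum>b\<in>B. c b * b i)) - (c x * u - 1) * x i"
      using dvd_mult[OF c'[of i], of u] u dvd_mult2[of "int p" "c x * u - 1" "x i"]
      by (intro dvd_diff) (auto simp: cong_iff_dvd_diff)
    also have "\<dots> = x i - (\<Sum>b\<in>B. - u * c b * b i)"
      by (simp add: algebra_simps sum_distrib_left sum_negf)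
    finally show "[x i = (\<Sum>b\<in>B. - u * c b * b i)] (mod (int p))" by (simp add: cong_iff_dvd_diff)
  qed
qed

text \<open>If no \<open>s + 1\<close> points of \<open>A\<close> were independent, a maximal
  independent subset \<open>B\<close> would have at most \<open>s\<close> points and every point of
  \<open>A\<close> would be a combination of \<open>B\<close>. With \<open>B\<close> enumerated
  first, all later points would lie in the span of the first \<open>s\<close>, contrary to the
  random choice.\<close>

lemma exists_set_with_independent_subsets:
  fixes i0 :: "'i::finite"
  assumes p: "prime p" and s: "0 < s" "s \<le> r"
    and lt: "T ^ r * (p ^ (s - 1)) ^ (r - s) < (p ^ (CARD('i) - 1)) ^ (r - s)"
  shows "\<exists>S\<subseteq>affine_box (int p) i0. T \<le> r * card S \<and> card S \<le> T \<and>
           (\<forall>A\<subseteq>S. card A = r \<longrightarrow> (\<exists>B\<subseteq>A. card B = s + 1 \<and> indep_mod (int p) B (\<lambda>v. v)))"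
proof -
  let ?V = "affine_box (int p) i0"
  have p1: "p > 1" using p prime_gt_1_nat by blast
  have p0: "int p > 0" using p1 by simp
  have ne: "?V \<noteq> {}"
  proof -
    have "(\<lambda>i. if i = i0 then 1 else 0) \<in> ?V" using p1 by (auto simp: affine_box_def)
    thus ?thesis by blast
  qed
  obtain S where S: "S \<subseteq> ?V" "T \<le> r * card S" "card S \<le> T"
    and key: "\<And>g. inj_on g {..<r} \<Longrightarrow> g ` {..<r} \<subseteq> S \<Longrightarrow> \<exists>t\<in>{s..<r}. g t \<notin> mod_span (int p) s g"
  proof -
    have "\<exists>S\<subseteq>?V. T \<le> r * card S \<and> card S \<le> T \<and>
           (\<forall>g. inj_on g {..<r} \<and> g ` {..<r} \<subseteq> S \<longrightarrow> (\<exists>t\<in>{s..<r}. g t \<notin> mod_span (int p) s g))"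
    proof (rule random_set)
      show "finite ?V" using p1 by (rule finite_affine_box)
      show "mod_span (int p) s g = mod_span (int p) s h" if "\<And>j. j < s \<Longrightarrow> g j = h j" for g h :: "nat \<Rightarrow> 'i \<Rightarrow> int"
        unfolding mod_span_def using that by simp
      show "card (mod_span (int p) s g \<inter> ?V) \<le> p ^ (s - 1)" if "\<And>j. j < s \<Longrightarrow> g j \<in> ?V" for g
        using p1 s that by (intro card_mod_span_le) auto
      show "g j \<in> mod_span (int p) s g" if "j < s" for g :: "nat \<Rightarrow> 'i \<Rightarrow> int" and j
        unfolding mod_span_def
      proof (intro CollectI exI[of _ "\<lambda>t. if t = j then 1 else 0"] conjI allI impI)
        fix i
        have "(\<Sum>t<s. (if t = j then 1 else 0) * g t i) = (\<Sum>t<s. if t = j then g t i else 0)"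
          by (intro sum.cong) auto
        also have "\<dots> = g j i" using that by simp
        finally show "[g j i = (\<Sum>t<s. (if t = j then 1 else 0) * g t i)] (mod (int p))" by simp
      qed (use p1 in auto)
      show "T ^ r * (p ^ (s - 1)) ^ (r - s) < card ?V ^ (r - s)"
        using lt card_affine_box[OF p1, of i0] by simp
    qed (use s ne in auto)
    thus ?thesis using that by blast
  qed
  have finS: "finite S" using S(1) finite_affine_box[OF p1] finite_subset by blast
  have "\<exists>B\<subseteq>A. card B = s + 1 \<and> indep_mod (int p) B (\<lambda>v. v)" if A: "A \<subseteq> S" "card A = r" for A
  proof (rule ccontr)
    assume neg: "\<not> ?thesis"
    have finA: "finite A" using A finS finite_subset by blast
    let ?I = "{B. B \<subseteq> A \<and> indep_mod (int p) B (\<lambda>v. v)}"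
    have "{} \<in> ?I" by (simp add: indep_mod_def)
    then obtain B where B: "B \<in> ?I" and max: "\<And>C. C \<in> ?I \<Longrightarrow> card C \<le> card B"
      using ex_has_greatest_nat[of "\<lambda>C. C \<in> ?I" "{}" card "Suc (card A)"] finA
      by (metis (no_types, lifting) card_mono le_imp_less_Suc mem_Collect_eq)
    have finB: "finite B" using B finA finite_subset by blast
    have cB: "card B \<le> s"
    proof (rule ccontr)
      assume "\<not> card B \<le> s"
      hence "s + 1 \<le> card B" by simp
      then obtain C where C: "C \<subseteq> B" "card C = s + 1" by (meson obtain_subset_with_card_n)
      hence "indep_mod (int p) C (\<lambda>v. v)" using indep_mod_subset B finB by blast
      thus False using neg B C by blast
    qed
    obtain g where g: "bij_betw g {..<card A} A" "bij_betw g {..<card B} B"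
      using ex_enum_extending[OF finA] B by blast
    have "inj_on g {..<r}" "g ` {..<r} \<subseteq> S" using g A by (auto simp: bij_betw_def)
    then obtain t where t: "t \<in> {s..<r}" "g t \<notin> mod_span (int p) s g" using key by blast
    have gA: "g t \<in> A" using g(1) t A by (auto simp: bij_betw_def)
    \<comment> \<open>Position \<open>t\<close> is at least \<open>s\<close>, hence past the initial
      block that enumerates \<open>B\<close>.\<close>
    have gB: "g t \<notin> B"
    proof
      assume "g t \<in> B"
      then obtain j where j: "j < card B" "g t = g j" using g(2) by (auto simp: bij_betw_def)
      hence "t = j" using g(1) t A cB s by (auto simp: bij_betw_def inj_on_def)
      thus False using t j cB by auto
    qed
    have "\<not> indep_mod (int p) (insert (g t) B) (\<lambda>v. v)"
    proof
      assume "indep_mod (int p) (insert (g t) B) (\<lambda>v. v)"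
      hence "card (insert (g t) B) \<le> card B" using max B gA by blast
      thus False using gB finB by simp
    qed
    then obtain e where e: "\<And>i. [g t i = (\<Sum>b\<in>B. e b * b i)] (mod (int p))"
      using dependent_imp_mod_combination[OF p finB _ gB] B by blast
    \<comment> \<open>\<open>B\<close> may have fewer than \<open>s\<close> elements: surplus
      coefficients are 0, the others are reduced to residues as \<open>mod_span\<close>
      asks.\<close>
    define e' where "e' = (\<lambda>j. if j < card B then e (g j) mod int p else 0)"
    have "[g t i = (\<Sum>j<s. e' j * g j i)] (mod (int p))" for i
    proof -
      have "(\<Sum>b\<in>B. e b * b i) = (\<Sum>j<card B. e (g j) * g j i)"
        using sum.reindex_bij_betw[OF g(2), of "\<lambda>b. e b * b i"] by simp
      moreover have "[(\<Sum>j<card B. e (g j) * g j i) = (\<Sum>j<card B. e' j * g j i)] (mod (int p))"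
        by (intro cong_sum cong_mult) (auto simp: e'_def Cong.cong_def)
      moreover have "(\<Sum>j<card B. e' j * g j i) = (\<Sum>j<s. e' j * g j i)"
        using cB by (intro sum.mono_neutral_left) (auto simp: e'_def)
      ultimately show ?thesis using e[of i] by (metis cong_trans)
    qed
    moreover have "\<forall>j<s. e' j \<in> {0..<int p}" using p0 by (auto simp: e'_def)
    ultimately have "g t \<in> mod_span (int p) s g" unfolding mod_span_def by blast
    thus False using t by blast
  qed
  with S show ?thesis by blast
qed

section \<open>Integer linear algebra\<close>

text \<open>Infinite descent: dividing an integer relation by \<open>p\<close> gives a relation
  again, so each coefficient is divisible by all powers of \<open>p\<close> and vanishes.\<close>

lemma indep_mod_prime_imp_indep_mod_0:
  fixes f :: "'b \<Rightarrow> 'i \<Rightarrow> int"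
  assumes p: "p > 1" and ind: "indep_mod p B f"
  shows "indep_mod 0 B f"
  unfolding indep_mod_def
proof (intro allI impI ballI)
  fix c b assume c: "\<forall>i. 0 dvd (\<Sum>b\<in>B. c b * f b i)" and b: "b \<in> B"
  have dvd: "\<forall>b\<in>B. p ^ n dvd c b" for n
  proof (induction n)
    case (Suc n)
    define c' where "c' = (\<lambda>b. c b div p ^ n)"
    have c': "c b = p ^ n * c' b" if "b \<in> B" for b using Suc that by (simp add: c'_def)
    have "(\<Sum>b\<in>B. c b * f b i) = p ^ n * (\<Sum>b\<in>B. c' b * f b i)" for i
      unfolding sum_distrib_left by (intro sum.cong) (auto simp: c')
    hence "(\<Sum>b\<in>B. c' b * f b i) = 0" for i using c p by simp
    hence "\<forall>b\<in>B. p dvd c' b" using ind unfolding indep_mod_def by simp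
    thus ?case using c' by simp
  qed simp
  show "0 dvd c b"
  proof (rule ccontr)
    assume "\<not> 0 dvd c b"
    hence nz: "c b \<noteq> 0" by simp
    \<comment> \<open>This power is large enough, since
      \<open>p ^ n \<ge> 2 ^ n > n\<close>.\<close>
    define n where "n = nat \<bar>c b\<bar>"
    have "p ^ n \<le> \<bar>c b\<bar>" using dvd[of n] b nz by (auto intro: zdvd_imp_le)
    moreover have "int n < 2 ^ n" using of_nat_less_two_power by blast
    moreover have "(2::int) ^ n \<le> p ^ n" using p by (intro power_mono) auto
    ultimately show False by (simp add: n_def)
  qed
qed

text \<open>Gaussian elimination without denominators: coordinate \<open>i\<close> is cleared with a
  pivot \<open>b0\<close> by cross multiplication, which keeps everything integral.\<close>

lemma ex_integer_dependency:
  fixes f :: "'b \<Rightarrow> 'i \<Rightarrow> int"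
  assumes "finite C" "finite B" "card C < card B"
  shows "\<exists>c. (\<exists>b\<in>B. c b \<noteq> 0) \<and> (\<forall>i\<in>C. (\<Sum>b\<in>B. c b * f b i) = 0)"
  using assms
proof (induction C arbitrary: B f rule: finite_induct)
  case empty
  then obtain b where "b \<in> B" by fastforce
  thus ?case by (intro exI[of _ "\<lambda>_. 1"]) auto
next
  case (insert i C)
  show ?case
  proof (cases "\<forall>b\<in>B. f b i = 0")
    case True
    obtain c where "\<exists>b\<in>B. c b \<noteq> 0" "\<forall>i\<in>C. (\<Sum>b\<in>B. c b * f b i) = 0"
      using insert.IH[of B f] insert.prems insert.hyps by auto
    with True show ?thesis by (intro exI[of _ c]) auto
  next
    case False
    then obtain b0 where b0: "b0 \<in> B" "f b0 i \<noteq> 0" by blast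
    define f' where "f' = (\<lambda>b j. f b0 i * f b j - f b i * f b0 j)"
    have "card C < card (B - {b0})" using insert b0 by simp
    then obtain c where c: "\<exists>b\<in>B - {b0}. c b \<noteq> 0" "\<forall>j\<in>C. (\<Sum>b\<in>B - {b0}. c b * f' b j) = 0"
      using insert.IH[of "B - {b0}" f'] insert.prems by blast
    \<comment> \<open>The coefficients other than that of \<open>b0\<close> are scaled by the
      nonzero pivot entry, so nontriviality survives; the one of \<open>b0\<close> collects what the
      elimination subtracted.\<close>
    define c' where "c' = (\<lambda>b. if b = b0 then - (\<Sum>b\<in>B - {b0}. c b * f b i) else c b * f b0 i)"
    have sum: "(\<Sum>b\<in>B. c' b * f b j) = (\<Sum>b\<in>B - {b0}. c b * f' b j)" for j
    proof -
      have "(\<Sum>b\<in>B. c' b * f b j) = c' b0 * f b0 j + (\<Sum>b\<in>B - {b0}. c' b * f b j)"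
        by (rule sum.remove) (use insert b0 in auto)
      also have "(\<Sum>b\<in>B - {b0}. c' b * f b j) = (\<Sum>b\<in>B - {b0}. c b * f b0 i * f b j)"
        by (intro sum.cong) (auto simp: c'_def)
      also have "c' b0 * f b0 j = - (\<Sum>b\<in>B - {b0}. c b * f b i * f b0 j)"
        by (simp add: c'_def sum_distrib_right)
      finally show ?thesis by (simp add: f'_def algebra_simps sum_subtractf)
    qed
    have "(\<Sum>b\<in>B. c' b * f b j) = 0" if "j \<in> insert i C" for j
      unfolding sum using c(2) that by (auto simp: f'_def algebra_simps)
    moreover have "\<exists>b\<in>B. c' b \<noteq> 0" using c(1) b0 by (auto simp: c'_def)
    ultimately show ?thesis by blast
  qed
qed

text \<open>Too many vectors would admit a joint dependency, that is \<open>u = - v\<close> with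
  \<open>u\<close> spanned by \<open>f\<close> and \<open>v\<close> by \<open>g\<close>.
  Orthogonality makes the squares of the entries of \<open>v\<close> sum to 0, so
  \<open>v = 0\<close>. This last step fails modulo a prime, hence the passage to characteristic 0,
  which also lets the two families come from different primes.\<close>

lemma orthogonal_indep_card_le:
  fixes f :: "'b \<Rightarrow> 'i::finite \<Rightarrow> int" and g :: "'c \<Rightarrow> 'i \<Rightarrow> int"
  assumes fin: "finite A" "finite B" and ind: "indep_mod 0 A f" "indep_mod 0 B g"
    and orth: "\<And>a b. a \<in> A \<Longrightarrow> b \<in> B \<Longrightarrow> (\<Sum>i\<in>UNIV. f a i * g b i) = 0"
  shows "card A + card B \<le> CARD('i)"
proof (rule ccontr)
  assume "\<not> ?thesis"
  hence "card (UNIV :: 'i set) < card (A <+> B)" using fin by (simp add: card_Plus)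
  then obtain c where c: "\<exists>x\<in>A <+> B. c x \<noteq> 0"
    "\<And>i. (\<Sum>x\<in>A <+> B. c x * case_sum f g x i) = 0"
    using ex_integer_dependency[of UNIV "A <+> B" "case_sum f g"] fin by (metis UNIV_I finite finite_Plus)
  define u where "u = (\<lambda>i. \<Sum>a\<in>A. c (Inl a) * f a i)"
  define v where "v = (\<lambda>i. \<Sum>b\<in>B. c (Inr b) * g b i)"
  have uv: "u i = - v i" for i
    using c(2)[of i] fin by (simp add: sum.Plus u_def v_def)
  have "(\<Sum>i\<in>UNIV. u i * v i) = (\<Sum>i\<in>UNIV. \<Sum>a\<in>A. \<Sum>b\<in>B. (c (Inl a) * c (Inr b)) * (f a i * g b i))"
    by (simp add: u_def v_def sum_product mult_ac)
  also have "\<dots> = (\<Sum>a\<in>A. \<Sum>b\<in>B. \<Sum>i\<in>UNIV. (c (Inl a) * c (Inr b)) * (f a i * g b i))"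
    by (subst sum.swap) (intro sum.cong refl sum.swap)
  also have "\<dots> = (\<Sum>a\<in>A. \<Sum>b\<in>B. (c (Inl a) * c (Inr b)) * (\<Sum>i\<in>UNIV. f a i * g b i))"
    by (simp add: sum_distrib_left)
  also have "\<dots> = 0" using orth by (intro sum.neutral ballI) simp
  finally have "(\<Sum>i\<in>UNIV. v i * v i) = 0" using uv by (simp add: sum_negf)
  hence "v i = 0" for i by (subst (asm) sum_nonneg_eq_0_iff) auto
  hence "u i = 0" "v i = 0" for i using uv[of i] by simp_all
  hence "\<forall>a\<in>A. c (Inl a) = 0" "\<forall>b\<in>B. c (Inr b) = 0"
    using ind(1)[unfolded indep_mod_def, rule_format, of "\<lambda>a. c (Inl a)"]
      ind(2)[unfolded indep_mod_def, rule_format, of "\<lambda>b. c (Inr b)"]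
    by (simp_all add: u_def v_def)
  thus False using c(1) by auto
qed

section \<open>Short multiples of vectors modulo a prime\<close>

text \<open>Allows the random normals to be replaced by their short multiples: the factors are units
  and only residues matter.\<close>

lemma indep_mod_scale:
  assumes ind: "indep_mod p B f" and l: "\<And>b. b \<in> B \<Longrightarrow> coprime (l b) p"
    and g: "\<And>b i. b \<in> B \<Longrightarrow> [g b i = l b * f b i] (mod p)"
  shows "indep_mod p B g"
  unfolding indep_mod_def
proof (intro allI impI)
  fix c assume c: "\<forall>i. p dvd (\<Sum>b\<in>B. c b * g b i)"
  have "p dvd (\<Sum>b\<in>B. (c b * l b) * f b i)" for i
  proof -
    have "[(\<Sum>b\<in>B. c b * g b i) = (\<Sum>b\<in>B. c b * (l b * f b i))] (mod p)"
      by (intro cong_sum cong_mult g) auto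
    thus ?thesis using c cong_dvd_iff by (metis (no_types, lifting) mult.assoc sum.cong)
  qed
  hence "\<forall>b\<in>B. p dvd c b * l b"
    using ind[unfolded indep_mod_def, rule_format, of "\<lambda>b. c b * l b"] by simp
  thus "\<forall>b\<in>B. p dvd c b" using l by (metis coprime_commute coprime_dvd_mult_left_iff)
qed

text \<open>Minkowski-type pigeonhole argument: two multiples of \<open>v\<close> modulo \<open>q\<close> lie in the same one of \<open>M ^ d\<close> boxes of
  side length \<open>L\<close>, and their difference is a short multiple of \<open>v\<close>.\<close>
lemma ex_short_multiple:
  fixes v :: "'i::finite \<Rightarrow> int"
  assumes M: "M ^ CARD('i) < q" "q \<le> M * L"
  obtains l w where "0 < l" "l < int q" "\<And>i. [w i = l * v i] (mod (int q))" "\<And>i. \<bar>w i\<bar> < int L"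
proof -
  have q: "q > 0" using M by simp
  hence L: "L > 0" using M by (cases L) auto
  define box where "box = (\<lambda>l::nat. \<lambda>i. nat ((int l * v i) mod int q) div L)"
  have "box ` {..<q} \<subseteq> UNIV \<rightarrow>\<^sub>E {..<M}"
  proof safe
    fix l i
    have "0 \<le> (int l * v i) mod int q" "(int l * v i) mod int q < int q" using q by simp_all
    moreover have "int q \<le> int (M * L)" using M by (simp only: of_nat_le_iff)
    ultimately have "nat ((int l * v i) mod int q) < M * L" by linarith
    thus "box l i < M" unfolding box_def using L by (simp add: div_less_iff_less_mult)
  qed auto
  hence "card (box ` {..<q}) \<le> card ((UNIV :: 'i set) \<rightarrow>\<^sub>E {..<M})"
    by (rule card_mono[rotated]) (auto intro!: finite_PiE)
  hence "card (box ` {..<q}) < card {..<q}" using M by (simp add: card_PiE)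
  hence "\<not> inj_on box {..<q}" by (rule pigeonhole)
  then obtain x y where xy: "x < y" "y < q" "box x = box y"
    by (metis (no_types, lifting) inj_onI lessThan_iff nat_neq_iff)
  define r where "r = (\<lambda>l i. (int l * v i) mod int q)"
  have r0: "r l i \<ge> 0" for l i using q by (simp add: r_def)
  show ?thesis
  proof (rule that[of "int y - int x" "\<lambda>i. r y i - r x i"])
    fix i
    have "[r y i - r x i = int y * v i - int x * v i] (mod (int q))"
      unfolding r_def by (intro cong_diff) (auto simp: Cong.cong_def)
    thus "[r y i - r x i = (int y - int x) * v i] (mod (int q))" by (simp add: algebra_simps)
    define a b where "a = nat (r x i)" and "b = nat (r y i)"
    have eq: "a div L = b div L" using fun_cong[OF xy(3), of i] by (simp add: box_def a_def b_def r_def)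
    have "a = L * (a div L) + a mod L" by simp
    moreover have "b = L * (a div L) + b mod L" unfolding eq by simp
    \<comment> \<open>Naming the common multiple of \<open>L\<close> hides the product
      \<open>L * (a div L)\<close> and leaves a linear problem.\<close>
    ultimately have "\<exists>k. a = k + a mod L \<and> b = k + b mod L"
      by (intro exI[of _ "L * (a div L)"]) (rule conjI)
    then obtain k where "a = k + a mod L" "b = k + b mod L" by blast
    moreover have "a mod L < L" "b mod L < L" using L by simp_all
    ultimately have "\<bar>int a - int b\<bar> < int L" by linarith
    thus "\<bar>r y i - r x i\<bar> < int L" using r0 by (simp add: a_def b_def)
  qed (use xy in auto)
qed

section \<open>Configurations from two primes\<close>

text \<open>The vector \<open>u\<close> is orthogonal to \<open>a\<close>, so moving along it stays
  in the hyperplane; since \<open>a'\<close> describes the same hyperplane, \<open>u\<close> is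
  orthogonal to \<open>a'\<close> as well.\<close>

lemma hyperplane_eq_imp_parallel:
  fixes a a' :: "real ^ 'd"
  assumes "{x. a \<bullet> x = b} = {x. a' \<bullet> x = b'}" "a \<noteq> 0"
  shows "a $ i * a' $ j = a $ j * a' $ i"
proof -
  define x0 where "x0 = (b / (a \<bullet> a)) *\<^sub>R a"
  define u :: "real ^ 'd" where "u = axis j (a $ i) - axis i (a $ j)"
  have "a \<bullet> x0 = b" using assms(2) by (simp add: x0_def)
  moreover have "a \<bullet> u = 0" by (simp add: u_def inner_diff_right inner_axis)
  ultimately have "x0 \<in> {x. a \<bullet> x = b}" "x0 + u \<in> {x. a \<bullet> x = b}" by (simp_all add: inner_add_right)
  hence "a' \<bullet> x0 = b'" "a' \<bullet> (x0 + u) = b'" unfolding assms(1) by simp_all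
  hence "a' \<bullet> u = 0" by (simp add: inner_add_right)
  thus ?thesis by (simp add: u_def inner_diff_right inner_axis algebra_simps)
qed

lemma sum_UNIV_option:
  fixes f :: "'d::finite option \<Rightarrow> int"
  shows "(\<Sum>i\<in>UNIV. f i) = f None + (\<Sum>i\<in>UNIV. f (Some i))"
  by (simp add: UNIV_option_conv sum.reindex)

text \<open>The hyperplanes are those through a point of \<open>S1\<close> with a short normal
  \<open>w v\<close>, \<open>v\<close> in \<open>S2\<close>, so every pair of a point and a normal
  yields an incidence. Inner products are at most \<open>d * p * L\<close> in absolute value, which
  leaves at most \<open>2 * d * p * L + 1\<close> hyperplanes per normal.\<close>

lemma ex_incidence_configuration:
  fixes K s :: nat
  assumes Ks: "0 < K" "0 < s" "K + s = CARD('d::finite)" and le: "K \<le> r1" "s \<le> r2"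
    and p: "prime p" "T1 ^ r1 * (p ^ (K - 1)) ^ (r1 - K) < (p ^ CARD('d)) ^ (r1 - K)"
    and q: "prime q" "T2 ^ r2 * (q ^ (s - 1)) ^ (r2 - s) < (q ^ (CARD('d) - 1)) ^ (r2 - s)"
    and M: "M ^ CARD('d) < q" "q \<le> M * L"
  shows "\<exists>(P :: (real ^ 'd) set) Hs. finite P \<and> card P \<le> T1 \<and> finite Hs \<and>
           card Hs \<le> T2 * (2 * (CARD('d) * p * L) + 1) \<and> (\<forall>H\<in>Hs. is_hyperplane H) \<and>
           \<not> contains_Krr (max r1 r2) P Hs \<and> T1 * T2 \<le> r1 * r2 * inc P Hs"
proof -
  define i0 :: 'd where "i0 = undefined"
  have p1: "p > 1" and q1: "q > 1" using p q prime_gt_1_nat by blast+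
  have pd: "T1 ^ r1 * (p ^ (K - 1)) ^ (r1 - K) < (p ^ (CARD('d option) - 1)) ^ (r1 - K)"
    using p(2) by (simp add: card_option)
  obtain S1 where S1: "S1 \<subseteq> affine_box (int p) (None :: 'd option)" "T1 \<le> r1 * card S1" "card S1 \<le> T1"
    and ind1: "\<And>A. A \<subseteq> S1 \<Longrightarrow> card A = r1 \<Longrightarrow> \<exists>B\<subseteq>A. card B = K + 1 \<and> indep_mod (int p) B (\<lambda>v. v)"
    using exists_set_with_independent_subsets[OF p(1) Ks(1) le(1) pd] by blast
  obtain S2 where S2: "S2 \<subseteq> affine_box (int q) i0" "T2 \<le> r2 * card S2" "card S2 \<le> T2"
    and ind2: "\<And>A. A \<subseteq> S2 \<Longrightarrow> card A = r2 \<Longrightarrow> \<exists>B\<subseteq>A. card B = s + 1 \<and> indep_mod (int q) B (\<lambda>v. v)"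
    using exists_set_with_independent_subsets[OF q(1) Ks(2) le(2) q(2)] by blast
  have S1D: "u None = 1" "u i \<in> {0..<int p}" if "u \<in> S1" for u i
    using that S1(1) unfolding affine_box_def by blast+
  have S2D: "v i0 = 1" "v i \<in> {0..<int q}" if "v \<in> S2" for v i
    using that S2(1) unfolding affine_box_def by blast+
  have fin1: "finite S1" using S1(1) finite_affine_box[OF p1] finite_subset by blast
  have fin2: "finite S2" using S2(1) finite_affine_box[OF q1] finite_subset by blast
  have "\<forall>v :: 'd \<Rightarrow> int. \<exists>x. 0 < fst x \<and> fst x < int q \<and>
      (\<forall>i. [snd x i = fst x * v i] (mod (int q))) \<and> (\<forall>i. \<bar>snd x i\<bar> < int L)"
  proof
    fix v :: "'d \<Rightarrow> int"
    obtain l w where "0 < l" "l < int q" "\<And>i. [w i = l * v i] (mod (int q))" "\<And>i. \<bar>w i\<bar> < int L"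
      using ex_short_multiple[OF M, of v] by blast
    thus "\<exists>x. 0 < fst x \<and> fst x < int q \<and>
      (\<forall>i. [snd x i = fst x * v i] (mod (int q))) \<and> (\<forall>i. \<bar>snd x i\<bar> < int L)"
      by (intro exI[of _ "(l, w)"]) simp
  qed
  from choice[OF this] obtain F :: "('d \<Rightarrow> int) \<Rightarrow> int \<times> ('d \<Rightarrow> int)" where
    F: "\<forall>v. 0 < fst (F v) \<and> fst (F v) < int q \<and>
      (\<forall>i. [snd (F v) i = fst (F v) * v i] (mod (int q))) \<and> (\<forall>i. \<bar>snd (F v) i\<bar> < int L)" by blast
  define l w where "l = (\<lambda>v. fst (F v))" and "w = (\<lambda>v. snd (F v))"
  have lw: "0 < l v" "l v < int q" "[w v i = l v * v i] (mod (int q))" "\<bar>w v i\<bar> < int L" for v i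
    using F by (simp_all add: l_def w_def)
  have cop: "coprime (l v) (int q)" for v :: "'d \<Rightarrow> int"
  proof -
    have "\<not> int q dvd l v" using lw(1,2)[of v] zdvd_not_zless by blast
    hence "coprime (int q) (l v)" using q(1) by (intro prime_imp_coprime) auto
    thus ?thesis by (simp add: coprime_commute)
  qed
  define pt :: "('d option \<Rightarrow> int) \<Rightarrow> real ^ 'd" where "pt = (\<lambda>u. \<chi> i. of_int (u (Some i)))"
  define nv :: "('d \<Rightarrow> int) \<Rightarrow> real ^ 'd" where "nv = (\<lambda>v. \<chi> i. of_int (w v i))"
  define ip where "ip = (\<lambda>v (u :: 'd option \<Rightarrow> int). \<Sum>i\<in>UNIV. w v i * u (Some i))"
  define hp where "hp = (\<lambda>v (c::int). {x. nv v \<bullet> x = of_int c})"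
  have mem: "pt u \<in> hp v c \<longleftrightarrow> ip v u = c" for u v c
  proof -
    have "nv v \<bullet> pt u = of_int (ip v u)" by (simp add: nv_def pt_def ip_def inner_vec_def)
    thus ?thesis by (simp add: hp_def)
  qed
  have inj_pt: "inj_on pt S1"
  proof (rule inj_onI)
    fix u u' assume u: "u \<in> S1" "u' \<in> S1" "pt u = pt u'"
    have "u i = u' i" for i
    proof (cases i)
      case None
      thus ?thesis using S1D(1)[OF u(1)] S1D(1)[OF u(2)] by simp
    next
      case (Some j)
      have "pt u $ j = pt u' $ j" using u by simp
      thus ?thesis using Some by (simp add: pt_def)
    qed
    thus "u = u'" by blast
  qed
  \<comment> \<open>Coordinate \<open>i0\<close> of \<open>w v\<close> is congruent to
    \<open>l v\<close>, which lies strictly between 0 and \<open>q\<close>.\<close>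
  have nv0: "nv v \<noteq> 0" if "v \<in> S2" for v
  proof
    assume "nv v = 0"
    hence "nv v $ i0 = 0" by simp
    hence "w v i0 = 0" by (simp add: nv_def)
    moreover have "v i0 = 1" by (rule S2D(1)[OF that])
    ultimately have "[0 = l v] (mod (int q))" using lw(3)[of v i0] by simp
    hence "int q dvd l v" by (simp add: Cong.cong_def mod_eq_0_iff_dvd)
    thus False using lw(1,2)[of v] zdvd_not_zless by blast
  qed
  \<comment> \<open>Parallel short normals come from vectors parallel modulo \<open>q\<close>, and
    their common entry 1 at \<open>i0\<close> makes these equal. Hence different normals never share
    a hyperplane and the incidences counted below are distinct.\<close>
  have hp_inj: "v = v'" if v: "v \<in> S2" "v' \<in> S2" and eq: "hp v c = hp v' c'" for v v' c c'
  proof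
    fix j
    have "nv v $ i0 * nv v' $ j = nv v $ j * nv v' $ i0"
      by (rule hyperplane_eq_imp_parallel[OF eq[unfolded hp_def] nv0[OF v(1)]])
    hence "real_of_int (w v i0 * w v' j) = real_of_int (w v j * w v' i0)" by (simp add: nv_def)
    hence e: "w v i0 * w v' j = w v j * w v' i0" by (simp only: of_int_eq_iff)
    have v0: "v i0 = 1" "v' i0 = 1" using S2D(1)[OF v(1)] S2D(1)[OF v(2)] by auto
    have "[w v i0 * w v' j = (l v * v i0) * (l v' * v' j)] (mod (int q))"
      by (intro cong_mult lw)
    moreover have "[w v j * w v' i0 = (l v * v j) * (l v' * v' i0)] (mod (int q))"
      by (intro cong_mult lw)
    ultimately have "[(l v * v i0) * (l v' * v' j) = (l v * v j) * (l v' * v' i0)] (mod (int q))"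
      unfolding e using cong_sym cong_trans by blast
    hence "[(l v * l v') * v' j = (l v * l v') * v j] (mod (int q))" using v0 by (simp add: mult_ac)
    moreover have "coprime (l v * l v') (int q)" using cop by simp
    ultimately have "[v' j = v j] (mod (int q))" by (simp only: cong_mult_lcancel)
    hence "v' j = v j" by (rule cong_imp_eq_atLeastLessThan) (rule S2D(2)[OF v(2)], rule S2D(2)[OF v(1)])
    thus "v j = v' j" by simp
  qed
  define P where "P = pt ` S1"
  define Hs where "Hs = (\<lambda>(v, u). hp v (ip v u)) ` (S2 \<times> S1)"
  define N where "N = CARD('d) * p * L"
  have ip_bound: "\<bar>ip v u\<bar> \<le> int N" if "u \<in> S1" for u v
  proof -
    have "\<bar>ip v u\<bar> \<le> (\<Sum>i\<in>UNIV. \<bar>w v i * u (Some i)\<bar>)" unfolding ip_def by (rule sum_abs)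
    also have "\<dots> \<le> (\<Sum>i\<in>(UNIV :: 'd set). int L * int p)"
    proof (rule sum_mono)
      fix i
      have "u (Some i) \<in> {0..<int p}" by (rule S1D(2)[OF that])
      thus "\<bar>w v i * u (Some i)\<bar> \<le> int L * int p"
        unfolding abs_mult using lw(4)[of v i] by (intro mult_mono) auto
    qed
    also have "\<dots> = int N" by (simp add: N_def)
    finally show ?thesis .
  qed
  have finP: "finite P" and finH: "finite Hs" using fin1 fin2 by (auto simp: P_def Hs_def)
  have cP: "card P \<le> T1" using S1(3) card_image_le[OF fin1, of pt] by (simp add: P_def)
  have "Hs \<subseteq> (\<lambda>(v, c). hp v c) ` (S2 \<times> {- int N..int N})"
  proof
    fix H assume "H \<in> Hs"
    then obtain v u where vu: "v \<in> S2" "u \<in> S1" "H = hp v (ip v u)" by (auto simp: Hs_def)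
    have "ip v u \<in> {- int N..int N}" using ip_bound[OF vu(2), of v] by (simp add: abs_le_iff)
    thus "H \<in> (\<lambda>(v, c). hp v c) ` (S2 \<times> {- int N..int N})" using vu by force
  qed
  hence "card Hs \<le> card ((\<lambda>(v, c). hp v c) ` (S2 \<times> {- int N..int N}))"
    by (rule card_mono[rotated]) (use fin2 in auto)
  also have "\<dots> \<le> card (S2 \<times> {- int N..int N})" by (rule card_image_le) (use fin2 in auto)
  also have "\<dots> = card S2 * (2 * N + 1)" by (simp add: card_cartesian_product nat_add_distrib nat_mult_distrib)
  also have "\<dots> \<le> T2 * (2 * N + 1)" by (intro mult_right_mono S2) auto
  finally have cH: "card Hs \<le> T2 * (2 * (CARD('d) * p * L) + 1)" by (simp add: N_def)
  have hyp: "\<forall>H\<in>Hs. is_hyperplane H"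
    using nv0 by (force simp: Hs_def hp_def is_hyperplane_def)
  have "T1 * T2 \<le> (r1 * card S1) * (r2 * card S2)" by (intro mult_mono S1 S2) auto
  also have "\<dots> = r1 * r2 * card (S1 \<times> S2)" by (simp add: card_cartesian_product)
  also have "card (S1 \<times> S2) \<le> inc P Hs"
    unfolding inc_def
  proof (rule card_inj_on_le)
    show "inj_on (\<lambda>(u, v). (pt u, hp v (ip v u))) (S1 \<times> S2)"
      using inj_pt hp_inj by (auto simp: inj_on_def)
    show "(\<lambda>(u, v). (pt u, hp v (ip v u))) ` (S1 \<times> S2) \<subseteq> {(p, H). p \<in> P \<and> H \<in> Hs \<and> p \<in> H}"
      by (auto simp: P_def Hs_def mem)
    show "finite {(p, H). p \<in> P \<and> H \<in> Hs \<and> p \<in> H}"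
      by (rule finite_subset[of _ "P \<times> Hs"]) (use finP finH in auto)
  qed
  finally have inc: "T1 * T2 \<le> r1 * r2 * inc P Hs" by simp
  have "\<not> contains_Krr (max r1 r2) P Hs"
  proof
    assume "contains_Krr (max r1 r2) P Hs"
    then obtain P' Hs' where P': "P' \<subseteq> P" "card P' = max r1 r2" and Hs': "Hs' \<subseteq> Hs" "card Hs' = max r1 r2"
      and all: "\<And>x H. x \<in> P' \<Longrightarrow> H \<in> Hs' \<Longrightarrow> x \<in> H"
      unfolding contains_Krr_def by blast
    obtain U where U: "U \<subseteq> S1" "P' = pt ` U" using P'(1) by (metis P_def subset_imageE)
    have finU: "finite U" using U fin1 finite_subset by blast
    have "r1 \<le> card U" using card_image_le[OF finU, of pt] U P' by simp
    then obtain A where A: "A \<subseteq> U" "card A = r1" by (meson obtain_subset_with_card_n)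
    then obtain B1 where B1: "B1 \<subseteq> A" "card B1 = K + 1" "indep_mod (int p) B1 (\<lambda>v. v)"
      using ind1[of A] U by blast
    have "card B1 > 0" using B1 by simp
    then obtain u0 where u0: "u0 \<in> B1" by (metis card_gt_0_iff ex_in_conv)
    hence u0U: "u0 \<in> U" using A B1 by blast
    \<comment> \<open>All hyperplanes of \<open>Hs'\<close> pass through \<open>pt u0\<close>, so
      each is determined by its normal, and many hyperplanes mean many normals.\<close>
    have ex: "\<exists>v\<in>S2. H = hp v (ip v u0)" if H: "H \<in> Hs'" for H
    proof -
      obtain v u where vu: "v \<in> S2" "H = hp v (ip v u)" using H Hs' by (auto simp: Hs_def)
      have "pt u0 \<in> H" using all U u0U H by blast
      hence "ip v u0 = ip v u" unfolding vu(2) mem .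
      hence "H = hp v (ip v u0)" using vu by simp
      thus ?thesis using vu(1) by blast
    qed
    define W where "W = {v\<in>S2. hp v (ip v u0) \<in> Hs'}"
    have finW: "finite W" using fin2 by (simp add: W_def)
    have "Hs' \<subseteq> (\<lambda>v. hp v (ip v u0)) ` W" using ex by (fastforce simp: W_def)
    hence "card Hs' \<le> card W" using finW by (meson card_image_le card_mono finite_imageI order_trans)
    hence "r2 \<le> card W" using Hs' by simp
    then obtain C where C: "C \<subseteq> W" "card C = r2" by (meson obtain_subset_with_card_n)
    have "C \<subseteq> S2" using C by (auto simp: W_def)
    then obtain B2 where B2: "B2 \<subseteq> C" "card B2 = s + 1" "indep_mod (int q) B2 (\<lambda>v. v)"
      using ind2[of C] C by blast
    have fB: "finite B1" "finite B2" using B1 B2 card_gt_0_iff by fastforce+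
    have i1: "indep_mod 0 B1 (\<lambda>v. v)"
      by (rule indep_mod_prime_imp_indep_mod_0[OF _ B1(3)]) (use p1 in simp)
    have "indep_mod (int q) B2 w" by (rule indep_mod_scale[OF B2(3)]) (use lw cop in auto)
    hence i2: "indep_mod 0 B2 w"
      by (rule indep_mod_prime_imp_indep_mod_0[rotated]) (use q1 in simp)
    \<comment> \<open>Homogeneous coordinates of the hyperplane through \<open>pt u0\<close> with
      normal \<open>w v\<close>: orthogonality to a vector with entry 1 at \<open>None\<close> is
      incidence. The added coordinate cannot destroy independence.\<close>
    define w' where "w' = (\<lambda>v. case_option (- ip v u0) (w v))"
    have i2': "indep_mod 0 B2 w'"
      unfolding indep_mod_def
    proof (intro allI impI)
      fix c assume c: "\<forall>i. 0 dvd (\<Sum>b\<in>B2. c b * w' b i)"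
      have "0 dvd (\<Sum>b\<in>B2. c b * w b i)" for i using c[rule_format, of "Some i"] by (simp add: w'_def)
      thus "\<forall>b\<in>B2. 0 dvd c b" using i2 unfolding indep_mod_def by blast
    qed
    have "card B1 + card B2 \<le> CARD('d option)"
    proof (rule orthogonal_indep_card_le[OF fB i1 i2'])
      fix u v assume u: "u \<in> B1" and v: "v \<in> B2"
      have "hp v (ip v u0) \<in> Hs'" using v B2 C by (auto simp: W_def)
      moreover have "pt u \<in> P'" using u B1 A U by blast
      ultimately have "pt u \<in> hp v (ip v u0)" by (rule all[rotated])
      hence "ip v u = ip v u0" by (simp add: mem)
      moreover have "u \<in> S1" using u A B1 U by blast
      hence "u None = 1" by (rule S1D(1))
      ultimately show "(\<Sum>i\<in>UNIV. u i * w' v i) = 0"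
        unfolding sum_UNIV_option by (simp add: w'_def ip_def mult.commute)
    qed
    thus False using B1 B2 Ks by (simp add: card_option)
  qed
  with finP finH cP cH hyp inc show ?thesis by blast
qed

section \<open>Numerical choices for given primes\<close>

text \<open>\<open>E\<close> is the codimension of a span in its box. The loss of
  \<open>\<delta>\<close> in the exponent, taken \<open>r\<close> times, outweighs the
  \<open>E * k\<close> that the first \<open>k\<close> points of a tuple fail to contribute.\<close>

lemma random_choice_condition:
  fixes p T :: nat and \<delta> :: real
  assumes p: "p > 1" and T: "real T \<le> real p powr (real E - \<delta>)" and k: "k \<le> r"
    and r: "real E * real k < \<delta> * real r" and B: "A + E = B" "0 < r"
  shows "T ^ r * (p ^ A) ^ (r - k) < (p ^ B) ^ (r - k)"
proof -
  have "real T ^ r \<le> (real p powr (real E - \<delta>)) ^ r" by (intro power_mono T) auto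
  also have "\<dots> = real p powr ((real E - \<delta>) * real r)"
    using p by (subst powr_realpow[symmetric]) (auto simp: powr_powr)
  also have "\<dots> < real p powr (real E * real (r - k))"
    using p r k by (intro powr_less_mono) (auto simp: algebra_simps of_nat_diff)
  also have "\<dots> = real (p ^ (E * (r - k)))"
    using p by (subst powr_realpow[symmetric] of_nat_power)+ simp_all
  finally have "real (T ^ r) < real (p ^ (E * (r - k)))" by simp
  hence "T ^ r < p ^ (E * (r - k))" by (simp only: of_nat_less_iff)
  moreover have "(p ^ A) ^ (r - k) > 0" using p by simp
  ultimately have "T ^ r * (p ^ A) ^ (r - k) < p ^ (E * (r - k)) * (p ^ A) ^ (r - k)"
    by (rule mult_strict_right_mono)
  also have "\<dots> = (p ^ B) ^ (r - k)"
    unfolding B(1)[symmetric] by (simp add: power_add power_mult power_mult_distrib mult.commute)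
  finally show ?thesis .
qed

text \<open>\<open>M\<close> is \<open>q powr (1 / d)\<close> rounded down and \<open>L\<close> is
  \<open>q / M\<close> rounded up; primality excludes \<open>M ^ d = q\<close>. The factor 3 is 2
  for the rounding of \<open>M\<close> plus 1 for that of \<open>L\<close>.\<close>

lemma ex_box_parameters:
  fixes q d :: nat
  assumes q: "prime q" and d: "d \<ge> 2"
  obtains M L :: nat where "M ^ d < q" "q \<le> M * L" "real L \<le> 3 * real q powr (1 - 1 / real d)"
proof -
  have q1: "q > 1" using q prime_gt_1_nat by blast
  define y where "y = real q powr (1 / real d)"
  have y1: "y \<ge> 1" unfolding y_def using q1 by (intro ge_one_powr_ge_zero) auto
  have yd: "y ^ d = real q"
    unfolding y_def using q1 d by (subst powr_realpow[symmetric]) (auto simp: powr_powr)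
  have yc: "real q / y = real q powr (1 - 1 / real d)"
    unfolding y_def using q1 by (simp add: powr_diff)
  define M where "M = nat \<lfloor>y\<rfloor>"
  have M: "real M \<le> y" "y < real M + 1" "M \<ge> 1" unfolding M_def using y1 by linarith+
  define L where "L = nat \<lceil>real q / real M\<rceil>"
  have "real M ^ d \<le> real q" unfolding yd[symmetric] using M by (intro power_mono) auto
  hence "real (M ^ d) \<le> real q" by simp
  hence "M ^ d \<le> q" by (simp only: of_nat_le_iff)
  moreover have "M ^ d \<noteq> q" using q d prime_power_iff[of M d] by auto
  ultimately have 1: "M ^ d < q" by simp
  have L: "real q / real M \<le> real L" "real L \<le> real q / real M + 1" unfolding L_def
    using zero_le_divide_iff[of "real q" "real M"] by linarith+
  have "real q \<le> real M * real L" using L(1) M(3) by (simp add: field_simps)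
  hence "real q \<le> real (M * L)" by simp
  hence 2: "q \<le> M * L" by (simp only: of_nat_le_iff)
  have "y \<le> 2 * real M" using M by linarith
  hence "real q / real M \<le> 2 * (real q / y)" using y1 M q1 by (simp add: field_simps)
  moreover have "1 \<le> real q / y"
    unfolding yc using q1 d by (intro ge_one_powr_ge_zero) auto
  ultimately have "real L \<le> 3 * (real q / y)" using L(2) by linarith
  with 1 2 show ?thesis using that yc by simp
qed

lemma half_le_floor:
  fixes x :: real
  assumes "x \<ge> 1"
  shows "x / 2 \<le> real (nat \<lfloor>x\<rfloor>)"
proof -
  have "real (nat \<lfloor>x\<rfloor>) = of_int \<lfloor>x\<rfloor>" using assms by simp
  moreover have "1 \<le> \<lfloor>x\<rfloor>" using assms by simp
  ultimately show ?thesis by linarith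
qed

text \<open>The order of quantifiers matters: \<open>r\<close> is fixed by \<open>\<delta>\<close>
  and the dimensions before the primes are chosen. Rounding both set sizes down costs the factor
  4.\<close>

lemma ex_configuration_primes:
  fixes K s :: nat and \<delta> :: real
  assumes Ks: "0 < K" "0 < s" "K + s = CARD('d::finite)" and \<delta>: "0 < \<delta>" "\<delta> < 1"
  shows "\<exists>r\<ge>2. \<forall>p q. prime p \<longrightarrow> prime q \<longrightarrow>
    (\<exists>(P :: (real ^ 'd) set) Hs. finite P \<and> real (card P) \<le> real p ^ (s + 1) \<and> finite Hs \<and>
       real (card Hs) \<le> 9 * real CARD('d) * real p * real q powr (real K + 1 - 1 / real CARD('d)) \<and>
       (\<forall>H\<in>Hs. is_hyperplane H) \<and> \<not> contains_Krr r P Hs \<and>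
       real p powr (real (s + 1) - \<delta>) * real q powr (real K - \<delta>) \<le> 4 * (real r)\<^sup>2 * real (inc P Hs))"
proof -
  define d where "d = CARD('d)"
  \<comment> \<open>The quotient is what \<open>random_choice_condition\<close> asks for the points;
    it covers the normals too, as \<open>K * s \<le> (s + 1) * K\<close>.\<close>
  define r where "r = nat \<lceil>real (s + 1) * real K / \<delta>\<rceil> + 1 + K + s"
  have "real (s + 1) * real K / \<delta> < real r" unfolding r_def by linarith
  hence r: "real (s + 1) * real K < \<delta> * real r" using \<delta> by (simp add: field_simps)
  have rKs: "K \<le> r" "s \<le> r" "r \<ge> 2" using Ks by (auto simp: r_def)
  have d2: "d \<ge> 2" using Ks by (simp add: d_def)
  show ?thesis
  proof (intro exI[of _ r] conjI allI impI)
    fix p q :: nat assume pq: "prime p" "prime q"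
    have p1: "p > 1" and q1: "q > 1" using pq prime_gt_1_nat by blast+
    define T1 where "T1 = nat \<lfloor>real p powr (real (s + 1) - \<delta>)\<rfloor>"
    define T2 where "T2 = nat \<lfloor>real q powr (real K - \<delta>)\<rfloor>"
    have T1: "real T1 \<le> real p powr (real (s + 1) - \<delta>)" unfolding T1_def by (intro of_nat_floor) simp
    have T2: "real T2 \<le> real q powr (real K - \<delta>)" unfolding T2_def by (intro of_nat_floor) simp
    have T1': "real p powr (real (s + 1) - \<delta>) / 2 \<le> real T1"
      unfolding T1_def using p1 \<delta> by (intro half_le_floor ge_one_powr_ge_zero) auto
    have T2': "real q powr (real K - \<delta>) / 2 \<le> real T2"
      unfolding T2_def using q1 \<delta> Ks by (intro half_le_floor ge_one_powr_ge_zero) auto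
    obtain M L where box: "M ^ CARD('d) < q" "q \<le> M * L" "real L \<le> 3 * real q powr (1 - 1 / real d)"
      using ex_box_parameters[OF pq(2) d2] unfolding d_def by blast
    have c1: "T1 ^ r * (p ^ (K - 1)) ^ (r - K) < (p ^ CARD('d)) ^ (r - K)"
      by (rule random_choice_condition[OF p1 T1]) (use r rKs Ks in auto)
    have "real K * real s < \<delta> * real r"
    proof -
      have "real K * real s \<le> real (s + 1) * real K" by (simp add: algebra_simps)
      thus ?thesis using r by linarith
    qed
    hence c2: "T2 ^ r * (q ^ (s - 1)) ^ (r - s) < (q ^ (CARD('d) - 1)) ^ (r - s)"
      by (intro random_choice_condition[OF q1 T2]) (use r rKs Ks in auto)
    obtain P :: "(real ^ 'd) set" and Hs where PH: "finite P" "card P \<le> T1" "finite Hs"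
           "card Hs \<le> T2 * (2 * (CARD('d) * p * L) + 1)" "\<forall>H\<in>Hs. is_hyperplane H"
           "\<not> contains_Krr (max r r) P Hs" "T1 * T2 \<le> r * r * inc P Hs"
      using ex_incidence_configuration[OF Ks rKs(1,2) pq(1) c1 pq(2) c2 box(1,2)] by blast
    have "real (card P) \<le> real T1" using PH(2) by simp
    also have "\<dots> \<le> real p powr (real (s + 1) - \<delta>)" by (rule T1)
    also have "real p powr (real (s + 1) - \<delta>) \<le> real p powr real (s + 1)"
      using p1 \<delta> by (intro powr_mono) auto
    also have "\<dots> = real p ^ (s + 1)" using p1 by (subst powr_realpow) auto
    finally have cP: "real (card P) \<le> real p ^ (s + 1)" .
    define z where "z = real q powr (1 - 1 / real d)"
    have z1: "z \<ge> 1" unfolding z_def using q1 d2 by (intro ge_one_powr_ge_zero) auto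
    have "real (card Hs) \<le> real (T2 * (2 * (CARD('d) * p * L) + 1))" using PH(4) by (simp only: of_nat_le_iff)
    also have "\<dots> = real T2 * (2 * (real d * real p * real L) + 1)" by (simp add: d_def algebra_simps)
    also have "\<dots> \<le> real q powr real K * (9 * real d * real p * z)"
    proof (intro mult_mono)
      have "real q powr (real K - \<delta>) \<le> real q powr real K" using q1 \<delta> by (intro powr_mono) auto
      thus "real T2 \<le> real q powr real K" using T2 by linarith
      have "real d * real p * real L \<le> real d * real p * (3 * z)"
        using box(3) by (intro mult_left_mono) (auto simp: z_def)
      moreover have "1 * 1 * 1 \<le> real d * real p * z" using z1 p1 d2 by (intro mult_mono) auto
      ultimately show "2 * (real d * real p * real L) + 1 \<le> 9 * real d * real p * z" by linarith
    qed auto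
    also have "\<dots> = 9 * real d * real p * real q powr (real K + 1 - 1 / real d)"
      using q1 by (simp add: z_def powr_add[symmetric] add_diff_eq mult.commute mult.left_commute)
    finally have cH: "real (card Hs) \<le> 9 * real d * real p * real q powr (real K + 1 - 1 / real d)" .
    have "(real p powr (real (s + 1) - \<delta>) / 2) * (real q powr (real K - \<delta>) / 2) \<le> real T1 * real T2"
      by (intro mult_mono T1' T2') auto
    also have "\<dots> = real (T1 * T2)" by simp
    also have "\<dots> \<le> real (r * r * inc P Hs)" using PH(7) by (simp only: of_nat_le_iff)
    finally have "real p powr (real (s + 1) - \<delta>) * real q powr (real K - \<delta>) \<le> 4 * (real r)\<^sup>2 * real (inc P Hs)"
      by (simp add: power2_eq_square)
    with PH cP cH show "\<exists>(P :: (real ^ 'd) set) Hs. finite P \<and> real (card P) \<le> real p ^ (s + 1) \<and> finite Hs \<and>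
       real (card Hs) \<le> 9 * real CARD('d) * real p * real q powr (real K + 1 - 1 / real CARD('d)) \<and>
       (\<forall>H\<in>Hs. is_hyperplane H) \<and> \<not> contains_Krr r P Hs \<and>
       real p powr (real (s + 1) - \<delta>) * real q powr (real K - \<delta>) \<le> 4 * (real r)\<^sup>2 * real (inc P Hs)"
      by (intro exI[of _ P] exI[of _ Hs]) (simp add: d_def)
  qed (use rKs in auto)
qed

section \<open>Balancing the parameters\<close>

text \<open>Since \<open>m \<le> n\<close>, moving the weight \<open>(x - y) / 2\<close> from the
  exponent of \<open>n\<close> to that of \<open>m\<close> can only decrease the product.\<close>

lemma balanced_powr_le:
  fixes n m x y :: real
  assumes "1 \<le> m" "m \<le> n" "y \<le> x"
  shows "(m * n) powr ((x + y) / 2) \<le> n powr x * m powr y"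
proof -
  have "m powr ((x - y) / 2) \<le> n powr ((x - y) / 2)" using assms by (intro powr_mono2) auto
  hence "m powr y * n powr ((x + y) / 2) * m powr ((x - y) / 2) \<le>
         m powr y * n powr ((x + y) / 2) * n powr ((x - y) / 2)"
    by (rule mult_left_mono) simp
  also have "m powr y * n powr ((x + y) / 2) * m powr ((x - y) / 2) = (m * n) powr ((x + y) / 2)"
  proof -
    have "m powr y * m powr ((x - y) / 2) = m powr ((x + y) / 2)"
      using assms by (simp flip: powr_add add: field_simps)
    thus ?thesis using assms by (simp add: powr_mult mult_ac)
  qed
  also have "m powr y * n powr ((x + y) / 2) * n powr ((x - y) / 2) = n powr x * m powr y"
  proof -
    have "n powr ((x + y) / 2) * n powr ((x - y) / 2) = n powr x"
      using assms by (simp flip: powr_add add: field_simps)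
    thus ?thesis by (simp add: mult_ac)
  qed
  finally show ?thesis .
qed

text \<open>\<open>X\<close> and \<open>Q\<close> are the ideal sizes of the two primes, exhausting
  both budgets: \<open>X powr a = n\<close> and \<open>9 * D * X * Q powr \<beta> = m\<close>.
  Primes slightly too small and random sets slightly too small together cost at most the power
  \<open>\<delta> * (D + 3)\<close> of \<open>m * n\<close>, because
  \<open>(1 - \<delta>) * (a - \<delta>) \<ge> a - \<delta> * (a + 1)\<close>, and likewise for
  \<open>K\<close>.\<close>

lemma configuration_powr_bound:
  fixes n m a K \<beta> D \<delta> :: real
  defines "X \<equiv> n powr (1 / a)"
  defines "y \<equiv> m / (9 * D * X)"
  defines "Q \<equiv> y powr (1 / \<beta>)"
  assumes nm: "1 \<le> m" "m \<le> n" and a: "1 \<le> a" "a + 1 \<le> D + 3" and K: "1 \<le> K" "K + 1 \<le> D + 3"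
    and \<beta>: "K \<le> \<beta>" and D: "1 \<le> D" and \<delta>: "0 < \<delta>" and Q: "1 \<le> Q"
    and bal: "K / \<beta> \<le> 1 - K / (a * \<beta>)"
  shows "(m * n) powr ((1 - K / (a * \<beta>) + K / \<beta>) / 2 - \<delta> * (D + 3))
           \<le> 9 * D * (X powr ((1 - \<delta>) * (a - \<delta>)) * Q powr ((1 - \<delta>) * (K - \<delta>)))"
proof -
  have n: "1 \<le> n" using nm by linarith
  have X1: "1 \<le> X" unfolding X_def using n a by (intro ge_one_powr_ge_zero) auto
  have \<beta>1: "1 \<le> \<beta>" using K \<beta> by linarith
  have DX: "1 \<le> 9 * D * X" using mult_mono[of 1 D 1 X] X1 D by simp
  have y0: "0 < y" unfolding y_def using DX nm by simp
  have y1: "1 \<le> y"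
  proof (rule ccontr)
    assume "\<not> 1 \<le> y"
    hence "y powr (1 / \<beta>) < 1 powr (1 / \<beta>)" using y0 \<beta>1 by (intro powr_less_mono2) auto
    thus False using Q by (simp add: Q_def)
  qed
  have ym: "y \<le> m" unfolding y_def using DX nm by (simp add: divide_le_eq mult_le_cancel_left1)
  define t where "t = \<delta> * (D + 3)"
  have "n powr (1 - t) \<le> n powr ((a - \<delta> * (a + 1)) / a)"
  proof (intro powr_mono)
    have "\<delta> * (a + 1) / a \<le> \<delta> * (a + 1) / 1" using a \<delta> by (intro divide_left_mono) auto
    also have "\<dots> \<le> t" unfolding t_def using a \<delta> by (simp add: mult_left_mono)
    finally show "1 - t \<le> (a - \<delta> * (a + 1)) / a" using a by (simp add: diff_divide_distrib)
  qed (use n in auto)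
  also have "\<dots> = X powr (a - \<delta> * (a + 1))" by (simp add: X_def powr_powr)
  also have "\<dots> \<le> X powr ((1 - \<delta>) * (a - \<delta>))"
    using X1 by (intro powr_mono) (simp_all add: algebra_simps)
  finally have 1: "n powr (1 - t) \<le> X powr ((1 - \<delta>) * (a - \<delta>))" .
  have "m powr t \<ge> y powr (\<delta> * (K + 1) / \<beta>)"
  proof -
    have "\<delta> * (K + 1) / \<beta> \<le> \<delta> * (K + 1) / 1" using \<beta>1 \<delta> K by (intro divide_left_mono) auto
    also have "\<dots> \<le> t" unfolding t_def using K \<delta> by (simp add: mult_left_mono)
    finally have "y powr (\<delta> * (K + 1) / \<beta>) \<le> y powr t" using y1 by (intro powr_mono) auto
    also have "\<dots> \<le> m powr t" using ym y1 \<delta> D by (intro powr_mono2) (auto simp: t_def)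
    finally show ?thesis .
  qed
  hence "y powr (K / \<beta>) / m powr t \<le> y powr (K / \<beta>) / y powr (\<delta> * (K + 1) / \<beta>)"
    using y1 nm by (intro divide_left_mono) auto
  also have "\<dots> = y powr ((K - \<delta> * (K + 1)) / \<beta>)" by (simp add: powr_diff diff_divide_distrib)
  also have "\<dots> = Q powr (K - \<delta> * (K + 1))" by (simp add: Q_def powr_powr)
  also have "\<dots> \<le> Q powr ((1 - \<delta>) * (K - \<delta>))"
    using Q by (intro powr_mono) (simp_all add: algebra_simps)
  finally have 2: "y powr (K / \<beta>) / m powr t \<le> Q powr ((1 - \<delta>) * (K - \<delta>))" .
  \<comment> \<open>The left side is \<open>(m / X) powr (K / \<beta>)\<close>, and
    \<open>m / X = 9 * D * y\<close>.\<close>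
  have "m powr (K / \<beta>) / n powr (K / (a * \<beta>)) = y powr (K / \<beta>) * (9 * D) powr (K / \<beta>)"
  proof -
    have "m / X = y * (9 * D)" unfolding y_def using X1 D by simp
    hence "(m / X) powr (K / \<beta>) = (y * (9 * D)) powr (K / \<beta>)" by simp
    thus ?thesis using y1 D nm X1 by (simp add: powr_divide powr_mult X_def powr_powr)
  qed
  also have "\<dots> \<le> y powr (K / \<beta>) * (9 * D)"
  proof (rule mult_left_mono)
    have "(9 * D) powr (K / \<beta>) \<le> (9 * D) powr 1" using D \<beta> \<beta>1 by (intro powr_mono) auto
    thus "(9 * D) powr (K / \<beta>) \<le> 9 * D" using D by simp
  qed simp
  finally have 3: "m powr (K / \<beta>) / n powr (K / (a * \<beta>)) \<le> y powr (K / \<beta>) * (9 * D)" .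
  have "(m * n) powr ((1 - K / (a * \<beta>) + K / \<beta>) / 2) \<le> n powr (1 - K / (a * \<beta>)) * m powr (K / \<beta>)"
    by (rule balanced_powr_le[OF nm bal])
  also have "\<dots> = n * (m powr (K / \<beta>) / n powr (K / (a * \<beta>)))" using n by (simp add: powr_diff)
  also have "\<dots> \<le> n * (y powr (K / \<beta>) * (9 * D))" using 3 n by (intro mult_left_mono) auto
  finally have "(m * n) powr ((1 - K / (a * \<beta>) + K / \<beta>) / 2) / (m * n) powr t \<le>
      n * (y powr (K / \<beta>) * (9 * D)) / (m * n) powr t" by (rule divide_right_mono) simp
  also have "\<dots> = 9 * D * ((n / n powr t) * (y powr (K / \<beta>) / m powr t))"
    using n nm by (simp add: powr_mult mult_ac)
  also have "\<dots> \<le> 9 * D * (X powr ((1 - \<delta>) * (a - \<delta>)) * Q powr ((1 - \<delta>) * (K - \<delta>)))"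
  proof (intro mult_left_mono mult_mono 2)
    show "n / n powr t \<le> X powr ((1 - \<delta>) * (a - \<delta>))" using 1 n by (simp add: powr_diff)
  qed (use D n in auto)
  finally show ?thesis by (simp add: powr_diff t_def)
qed

text \<open>Serves the ranges of \<open>n\<close> and \<open>m\<close> that leave no room for the
  primes: one hyperplane cannot take part in a \<open>K_{r,r}\<close> with \<open>r \<ge> 2\<close>,
  however many points it carries.\<close>

lemma ex_trivial_configuration:
  assumes "CARD('d::finite) \<ge> 2" "r \<ge> 2"
  shows "\<exists>(P :: (real ^ 'd) set) Hs. finite P \<and> card P = n \<and> finite Hs \<and> card Hs = 1 \<and>
    (\<forall>H\<in>Hs. is_hyperplane H) \<and> \<not> contains_Krr r P Hs \<and> inc P Hs = n"
proof -
  have "\<exists>i j :: 'd. i \<noteq> j"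
  proof (rule ccontr)
    assume "\<not> ?thesis"
    hence "card (UNIV :: 'd set) \<le> Suc 0" by (subst card_le_Suc0_iff_eq) auto
    thus False using assms by simp
  qed
  then obtain i j :: 'd where ij: "i \<noteq> j" by blast
  define H where "H = {x :: real ^ 'd. axis i 1 \<bullet> x = 0}"
  define P where "P = (\<lambda>t. real t *\<^sub>R (axis j 1 :: real ^ 'd)) ` {..<n}"
  have inj: "inj_on (\<lambda>t. real t *\<^sub>R (axis j 1 :: real ^ 'd)) {..<n}"
    by (auto simp: inj_on_def axis_eq_0_iff)
  have P: "finite P" "card P = n" unfolding P_def using inj by (simp_all add: card_image)
  have PH: "x \<in> H" if "x \<in> P" for x using that ij by (auto simp: P_def H_def inner_axis_axis)
  have "is_hyperplane H" unfolding is_hyperplane_def H_def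
    by (intro exI[of _ "axis i 1"] exI[of _ 0]) (simp add: axis_eq_0_iff)
  moreover have "\<not> contains_Krr r P {H}"
  proof
    assume "contains_Krr r P {H}"
    then obtain Hs' where "Hs' \<subseteq> {H}" "card Hs' = r" unfolding contains_Krr_def by blast
    hence "r \<le> 1" using card_mono[of "{H}" Hs'] by simp
    thus False using assms by simp
  qed
  moreover have "inc P {H} = n"
  proof -
    have "{(p, H'). p \<in> P \<and> H' \<in> {H} \<and> p \<in> H'} = P \<times> {H}" using PH by auto
    thus ?thesis unfolding inc_def using P by (simp add: card_cartesian_product)
  qed
  ultimately show ?thesis using P by (intro exI[of _ P] exI[of _ "{H}"]) simp
qed

text \<open>If \<open>X\<close> or \<open>Q\<close> is below the threshold for primes,
  \<open>m\<close> is at most a constant times \<open>n powr (1 / a)\<close>. Then \<open>n\<close>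
  incidences on one hyperplane suffice, because the exponent is at most
  \<open>a / (a + 1)\<close>.\<close>

lemma ex_unbalanced_configuration:
  fixes K s :: nat and \<epsilon> :: real
  defines "a \<equiv> real (s + 1)" and "\<beta> \<equiv> real K + 1 - 1 / real CARD('d::finite)"
  assumes Ks: "0 < K" "0 < s" "K + s = CARD('d)" and \<epsilon>: "0 < \<epsilon>" "\<epsilon> < 1"
    and bal: "real K / \<beta> \<le> 1 - real K / (a * \<beta>)"
  shows "\<exists>r\<ge>1. \<exists>c>0. \<forall>n m :: nat. 1 \<le> m \<longrightarrow> m \<le> n \<longrightarrow>
    (\<exists>(P :: (real ^ 'd) set) Hs. finite P \<and> card P \<le> n \<and> finite Hs \<and> card Hs \<le> m \<and>
       (\<forall>H\<in>Hs. is_hyperplane H) \<and> \<not> contains_Krr r P Hs \<and>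
       c * (real m * real n) powr ((1 - real K / (a * \<beta>) + real K / \<beta>) / 2 - \<epsilon>) \<le> real (inc P Hs))"
proof -
  define D where "D = real CARD('d)"
  define E where "E = (1 - real K / (a * \<beta>) + real K / \<beta>) / 2"
  define \<delta> where "\<delta> = \<epsilon> / (D + 3)"
  have D: "D \<ge> 2" using Ks by (simp add: D_def)
  have KsD: "real K + real s = D" unfolding D_def using Ks(3) by (metis of_nat_add)
  have \<delta>: "0 < \<delta>" "\<delta> < 1" using \<epsilon> D by (simp_all add: \<delta>_def)
  have \<delta>D: "\<delta> * (D + 3) = \<epsilon>" using D by (simp add: \<delta>_def)
  have a: "a \<ge> 1" "a + 1 \<le> D + 3" using KsD Ks by (simp_all add: a_def)
  have K: "real K \<ge> 1" "real K + 1 \<le> D + 3" using KsD Ks by simp_all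
  have \<beta>: "real K \<le> \<beta>" using D by (simp add: \<beta>_def D_def)
  have \<beta>1: "1 \<le> \<beta>" using \<beta> K by linarith
  obtain r where r: "r \<ge> 2" and conf: "\<And>p q. prime p \<Longrightarrow> prime q \<Longrightarrow>
    (\<exists>(P :: (real ^ 'd) set) Hs. finite P \<and> real (card P) \<le> real p ^ (s + 1) \<and> finite Hs \<and>
       real (card Hs) \<le> 9 * D * real p * real q powr \<beta> \<and>
       (\<forall>H\<in>Hs. is_hyperplane H) \<and> \<not> contains_Krr r P Hs \<and>
       real p powr (a - \<delta>) * real q powr (real K - \<delta>) \<le> 4 * (real r)\<^sup>2 * real (inc P Hs))"
    using ex_configuration_primes[OF Ks \<delta>] unfolding D_def \<beta>_def a_def by blast
  obtain x0 where x0: "x0 \<ge> 1"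
    and primes: "\<And>x::real. x \<ge> x0 \<Longrightarrow> \<exists>p::nat. prime p \<and> x powr (1 - \<delta>) \<le> real p \<and> real p \<le> x"
    using exists_prime_between[OF \<delta>] by blast
  \<comment> \<open>The two summands serve the two failures: \<open>X < x0\<close> bounds
    \<open>n\<close> by \<open>x0 powr a\<close>, and \<open>Q < x0\<close> bounds
    \<open>m / X\<close> by \<open>9 * D * x0 powr \<beta>\<close>.\<close>
  define C where "C = 9 * D * (x0 powr a + x0 powr \<beta>)"
  have C: "C \<ge> 1" "x0 powr a \<le> C" "9 * D * x0 powr \<beta> \<le> C"
  proof -
    have "1 \<le> x0 powr a" using x0 a by (intro ge_one_powr_ge_zero) auto
    moreover have "0 \<le> x0 powr \<beta>" by simp
    moreover have "1 * x0 powr a \<le> 9 * D * x0 powr a" "0 \<le> 9 * D * x0 powr \<beta>"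
      using D by (intro mult_right_mono mult_nonneg_nonneg; simp)+
    ultimately show "C \<ge> 1" "x0 powr a \<le> C" "9 * D * x0 powr \<beta> \<le> C"
      unfolding C_def distrib_left by linarith+
  qed
  define c where "c = min (1 / C) (1 / (4 * (real r)\<^sup>2 * (9 * D)))"
  have c: "c > 0" "c \<le> 1 / C" "c \<le> 1 / (4 * (real r)\<^sup>2 * (9 * D))"
    using C D r by (auto simp: c_def)
  \<comment> \<open>With \<open>k = K / \<beta>\<close>, \<open>bal\<close> says
    \<open>k \<le> a / (a + 1)\<close>, and \<open>2 * E = 1 + k * (a - 1) / a\<close> grows with
    \<open>k\<close>.\<close>
  have Ea: "E \<le> a / (a + 1)"
  proof -
    define k where "k = real K / \<beta>"
    have "real K / (a * \<beta>) = k / a" by (simp add: k_def mult.commute)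
    hence b: "k \<le> 1 - k / a" and E: "E = (1 - k / a + k) / 2"
      using bal unfolding E_def k_def by metis+
    have ka: "k * (a + 1) \<le> a" using b a by (simp add: field_simps)
    have "k * (a + 1) * (a - 1) \<le> a * (a - 1)" using ka a by (intro mult_right_mono) auto
    hence "(a - k + k * a) * (a + 1) / (2 * a) \<le> (2 * a * a) / (2 * a)"
      using a by (intro divide_right_mono) (simp_all add: algebra_simps)
    moreover have "E = (a - k + k * a) / (2 * a)"
      unfolding E using a by (simp add: add_divide_distrib diff_divide_distrib)
    ultimately have "E * (a + 1) \<le> a" using a by simp
    thus ?thesis using a by (simp add: pos_le_divide_eq)
  qed
  show ?thesis
  proof (intro exI[of _ r] exI[of _ c] conjI allI impI)
    fix n m :: nat assume mn: "1 \<le> m" "m \<le> n"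
    define X where "X = real n powr (1 / a)"
    define y where "y = real m / (9 * D * X)"
    define Q where "Q = y powr (1 / \<beta>)"
    have n: "real n \<ge> 1" "real m \<ge> 1" "real m \<le> real n" using mn by simp_all
    have X1: "1 \<le> X" unfolding X_def using n a by (intro ge_one_powr_ge_zero) auto
    have Xa: "X powr a = real n" unfolding X_def using n a by (simp add: powr_powr)
    have y0: "y > 0" unfolding y_def using n D X1 by simp
    have Qb: "Q powr \<beta> = y" unfolding Q_def using \<beta>1 y0 by (simp add: powr_powr)
    show "\<exists>(P :: (real ^ 'd) set) Hs. finite P \<and> card P \<le> n \<and> finite Hs \<and> card Hs \<le> m \<and>
       (\<forall>H\<in>Hs. is_hyperplane H) \<and> \<not> contains_Krr r P Hs \<and>
       c * (real m * real n) powr ((1 - real K / (a * \<beta>) + real K / \<beta>) / 2 - \<epsilon>) \<le> real (inc P Hs)"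
    proof (cases "X \<ge> x0 \<and> Q \<ge> x0")
      case True
      then obtain p q where p: "prime p" "X powr (1 - \<delta>) \<le> real p" "real p \<le> X"
        and q: "prime q" "Q powr (1 - \<delta>) \<le> real q" "real q \<le> Q"
        using primes by blast
      have Q1: "1 \<le> Q" using True x0 by linarith
      obtain P :: "(real ^ 'd) set" and Hs where PH: "finite P" "real (card P) \<le> real p ^ (s + 1)"
        "finite Hs" "real (card Hs) \<le> 9 * D * real p * real q powr \<beta>"
        "\<forall>H\<in>Hs. is_hyperplane H" "\<not> contains_Krr r P Hs"
        "real p powr (a - \<delta>) * real q powr (real K - \<delta>) \<le> 4 * (real r)\<^sup>2 * real (inc P Hs)"
        using conf[OF p(1) q(1)] by blast
      have "real p ^ (s + 1) \<le> X ^ (s + 1)" using p by (intro power_mono) auto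
      also have "\<dots> = X powr a" unfolding a_def using X1 by (subst powr_realpow) auto
      finally have cP: "card P \<le> n" using PH(2) Xa by simp
      have "real q powr \<beta> \<le> Q powr \<beta>" using q \<beta>1 by (intro powr_mono2) auto
      hence "9 * D * real p * real q powr \<beta> \<le> 9 * D * X * y"
        unfolding Qb using p D by (intro mult_mono mult_left_mono) auto
      also have "\<dots> = real m" using D X1 by (simp add: y_def)
      finally have cH: "card Hs \<le> m" using PH(4) by simp
      have "(real m * real n) powr (E - \<epsilon>) \<le>
         9 * D * (X powr ((1 - \<delta>) * (a - \<delta>)) * Q powr ((1 - \<delta>) * (real K - \<delta>)))"
        using configuration_powr_bound[of "real m" "real n" a D "real K" \<beta> \<delta>]
          n a K \<beta> D \<delta> Q1 bal unfolding E_def X_def y_def Q_def \<delta>D by simp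
      also have "\<dots> \<le> 9 * D * (real p powr (a - \<delta>) * real q powr (real K - \<delta>))"
      proof (intro mult_left_mono mult_mono)
        show "X powr ((1 - \<delta>) * (a - \<delta>)) \<le> real p powr (a - \<delta>)"
          using p(2) a \<delta> by (subst powr_powr[symmetric]) (intro powr_mono2; simp)
        show "Q powr ((1 - \<delta>) * (real K - \<delta>)) \<le> real q powr (real K - \<delta>)"
          using q(2) K \<delta> by (subst powr_powr[symmetric]) (intro powr_mono2; simp)
      qed (use D in auto)
      also have "\<dots> \<le> 9 * D * (4 * (real r)\<^sup>2 * real (inc P Hs))"
        using PH(7) D by (intro mult_left_mono) auto
      finally have le: "(real m * real n) powr (E - \<epsilon>) \<le> 9 * D * (4 * (real r)\<^sup>2 * real (inc P Hs))" .
      have "c * (real m * real n) powr (E - \<epsilon>) \<le>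
        1 / (4 * (real r)\<^sup>2 * (9 * D)) * (9 * D * (4 * (real r)\<^sup>2 * real (inc P Hs)))"
        using c le D by (intro mult_mono) auto
      also have "\<dots> = real (inc P Hs)" using D r by simp
      finally show ?thesis using PH cP cH unfolding E_def by blast
    next
      case False
      obtain P :: "(real ^ 'd) set" and Hs where PH: "finite P" "card P = n" "finite Hs" "card Hs = 1"
        "\<forall>H\<in>Hs. is_hyperplane H" "\<not> contains_Krr r P Hs" "inc P Hs = n"
        using ex_trivial_configuration[of r n, where ?'d = 'd] r Ks by auto
      have "real m \<le> C * X"
      proof (cases "X < x0")
        case True
        hence "X powr a \<le> x0 powr a" using X1 a by (intro powr_mono2) auto
        hence "real m \<le> C" using Xa n C by linarith
        also have "\<dots> \<le> C * X" using C X1 by (simp add: mult_le_cancel_left1)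
        finally show ?thesis .
      next
        case F: False
        hence "Q powr \<beta> \<le> x0 powr \<beta>" using False \<beta>1 by (intro powr_mono2) (auto simp: Q_def)
        hence "9 * D * y \<le> 9 * D * x0 powr \<beta>" unfolding Qb using D by (intro mult_left_mono) auto
        hence "9 * D * y \<le> C" using C by linarith
        hence "9 * D * y * X \<le> C * X" using X1 by (intro mult_right_mono) auto
        moreover have "9 * D * y * X = real m" using D X1 by (simp add: y_def)
        ultimately show ?thesis by simp
      qed
      hence "real m * real n \<le> C * X * real n" using n by (intro mult_right_mono) auto
      also have "\<dots> = C * real n powr ((a + 1) / a)"
        using n a by (simp add: X_def add_divide_distrib powr_add)
      finally have mn': "real m * real n \<le> C * real n powr ((a + 1) / a)" .
      have mn1: "1 \<le> real m * real n" using n mult_mono[of 1 "real m" 1 "real n"] by simp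
      have "(real m * real n) powr (E - \<epsilon>) \<le> (real m * real n) powr (a / (a + 1))"
        using mn1 Ea \<epsilon> by (intro powr_mono) auto
      also have "\<dots> \<le> (C * real n powr ((a + 1) / a)) powr (a / (a + 1))"
        using mn1 mn' a by (intro powr_mono2) auto
      also have "\<dots> = C powr (a / (a + 1)) * real n"
        using C n a by (simp add: powr_mult powr_powr)
      also have "\<dots> \<le> C powr 1 * real n"
        using C a by (intro mult_right_mono powr_mono) auto
      also have "\<dots> = C * real n" using C by simp
      finally have le: "(real m * real n) powr (E - \<epsilon>) \<le> C * real n" .
      have "c * (real m * real n) powr (E - \<epsilon>) \<le> 1 / C * (C * real n)"
        using c le C by (intro mult_mono) auto
      also have "\<dots> = real (inc P Hs)" using C PH by simp
      finally show ?thesis using PH mn unfolding E_def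
        by (intro exI[of _ P] exI[of _ Hs]) simp
    qed
  qed (use r c in auto)
qed

section \<open>Duality and padding\<close>

text \<open>Finitely many hyperplanes and points form a null set; if the rest were finite, the whole
  space would be null. Infinitude allows many new points to be drawn at once.\<close>

lemma ex_generic_point:
  fixes a :: "'b \<Rightarrow> real ^ 'd::finite" and b :: "'b \<Rightarrow> real"
  assumes "finite I" "finite P" "\<And>i. i \<in> I \<Longrightarrow> a i \<noteq> 0"
  shows "infinite {t. t \<notin> P \<and> (\<forall>i\<in>I. a i \<bullet> t \<noteq> b i)}"
proof
  assume fin: "finite {t. t \<notin> P \<and> (\<forall>i\<in>I. a i \<bullet> t \<noteq> b i)}"
  have "negligible (\<Union>i\<in>I. {t. a i \<bullet> t = b i})"
    using assms by (intro negligible_Union) (auto intro!: negligible_hyperplane)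
  from negligible_Un[OF negligible_Un[OF this negligible_finite[OF assms(2)]] negligible_finite[OF fin]]
  have "negligible ((\<Union>i\<in>I. {t. a i \<bullet> t = b i}) \<union> P \<union> {t. t \<notin> P \<and> (\<forall>i\<in>I. a i \<bullet> t \<noteq> b i)})" .
  also have "(\<Union>i\<in>I. {t. a i \<bullet> t = b i}) \<union> P \<union> {t. t \<notin> P \<and> (\<forall>i\<in>I. a i \<bullet> t \<noteq> b i)} = UNIV" by auto
  finally show False by simp
qed

lemma contains_KrrE:
  assumes "contains_Krr r P Hs"
  obtains A B where "A \<subseteq> P" "B \<subseteq> Hs" "card A = r" "card B = r"
    "\<forall>p\<in>A. \<forall>H\<in>B. p \<in> H"
  using assms unfolding contains_Krr_def by blast

lemma hyperplanes_representation:
  assumes "\<forall>H\<in>Hs. is_hyperplane H"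
  obtains a b where "\<And>H. H \<in> Hs \<Longrightarrow> a H \<noteq> 0" "\<And>H. H \<in> Hs \<Longrightarrow> H = {x. a H \<bullet> x = b H}"
proof -
  have "\<forall>H\<in>Hs. \<exists>ab. fst ab \<noteq> 0 \<and> H = {x. fst ab \<bullet> x = snd ab}"
    using assms unfolding is_hyperplane_def by force
  from bchoice[OF this] obtain f where "\<forall>H\<in>Hs. fst (f H) \<noteq> 0 \<and> H = {x. fst (f H) \<bullet> x = snd (f H)}" by blast
  thus ?thesis using that[of "\<lambda>H. fst (f H)" "\<lambda>H. snd (f H)"] by blast
qed

text \<open>Point-hyperplane duality: after a generic translation no point is the origin and no hyperplane passes through it,
  so that \<open>u \<mapsto> {y. u \<bullet> y = 1}\<close> and its inverse are defined everywhere.\<close>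
lemma ex_dual_configuration:
  fixes P :: "(real ^ 'd) set"
  assumes fin: "finite P" "finite Hs" and hyp: "\<forall>H\<in>Hs. is_hyperplane H"
  shows "\<exists>(P' :: (real ^ 'd) set) Hs'. finite P' \<and> card P' = card Hs \<and> finite Hs' \<and> card Hs' = card P \<and>
    (\<forall>H\<in>Hs'. is_hyperplane H) \<and> (\<forall>r. contains_Krr r P' Hs' \<longrightarrow> contains_Krr r P Hs) \<and>
    inc P' Hs' = inc P Hs"
proof -
  obtain a b where ab: "\<And>H. H \<in> Hs \<Longrightarrow> a H \<noteq> 0" "\<And>H. H \<in> Hs \<Longrightarrow> H = {x. a H \<bullet> x = b H}"
    using hyperplanes_representation[OF hyp] by metis
  have "infinite {t. t \<notin> uminus ` P \<and> (\<forall>H\<in>Hs. a H \<bullet> t \<noteq> - b H)}"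
    by (rule ex_generic_point) (use fin ab in auto)
  hence "{t. t \<notin> uminus ` P \<and> (\<forall>H\<in>Hs. a H \<bullet> t \<noteq> - b H)} \<noteq> {}" by (rule infinite_imp_nonempty)
  then obtain t where t: "t \<notin> uminus ` P" "\<And>H. H \<in> Hs \<Longrightarrow> a H \<bullet> t \<noteq> - b H"
    by blast
  have t0: "x + t \<noteq> 0" if "x \<in> P" for x
    using t(1) that by (metis add.inverse_unique image_eqI)
  have b0: "b H + a H \<bullet> t \<noteq> 0" if "H \<in> Hs" for H using t(2)[OF that] by linarith
  define f where "f = (\<lambda>x. {y. (x + t) \<bullet> y = 1})"
  \<comment> \<open>The translate of \<open>H\<close> by \<open>t\<close> is
    \<open>{z. a H \<bullet> z = b H + a H \<bullet> t}\<close>; \<open>g H\<close> is its normal,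
    scaled to make the right side 1.\<close>
  define g where "g = (\<lambda>H. (1 / (b H + a H \<bullet> t)) *\<^sub>R a H)"
  have mem: "g H \<in> f x \<longleftrightarrow> x \<in> H" if "H \<in> Hs" for x H
  proof -
    have "x \<in> H \<longleftrightarrow> a H \<bullet> x = b H" by (subst ab(2)[OF that]) simp
    moreover have "g H \<in> f x \<longleftrightarrow> a H \<bullet> (x + t) = b H + a H \<bullet> t"
      using b0[OF that] by (auto simp: f_def g_def inner_commute field_simps)
    ultimately show ?thesis by (simp add: inner_add_right)
  qed
  have inj_f: "inj_on f P"
  proof (rule inj_onI)
    fix x x' assume x: "x \<in> P" "x' \<in> P" "f x = f x'"
    \<comment> \<open>The test point is the multiple of \<open>u\<close> on the hyperplane of
      \<open>u\<close>. Used in both directions, this makes \<open>u - v\<close> orthogonal to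
      itself.\<close>
    have *: "v \<bullet> u = u \<bullet> u" if "u \<noteq> 0" "{y. u \<bullet> y = 1} = {y. v \<bullet> y = 1}" for u v :: "real ^ 'd"
    proof -
      have "(1 / (u \<bullet> u)) *\<^sub>R u \<in> {y. u \<bullet> y = 1}" using that(1) by simp
      hence "(1 / (u \<bullet> u)) *\<^sub>R u \<in> {y. v \<bullet> y = 1}" unfolding that(2) .
      hence "v \<bullet> ((1 / (u \<bullet> u)) *\<^sub>R u) = 1" by (rule CollectD)
      thus ?thesis using that(1) by (simp add: field_simps)
    qed
    define u v where "u = x + t" and "v = x' + t"
    have "v \<bullet> u = u \<bullet> u" "u \<bullet> v = v \<bullet> v"
      using *[of u v] *[of v u] t0 x by (simp_all add: f_def u_def v_def)
    hence "(u - v) \<bullet> (u - v) = 0" by (simp add: inner_diff_left inner_diff_right inner_commute)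
    thus "x = x'" by (simp add: u_def v_def)
  qed
  have inj_g: "inj_on g Hs"
  proof (rule inj_onI)
    fix H H' assume H: "H \<in> Hs" "H' \<in> Hs" "g H = g H'"
    have "x \<in> H \<longleftrightarrow> x \<in> H'" for x using mem[OF H(1), of x] mem[OF H(2), of x] H(3) by simp
    thus "H = H'" by blast
  qed
  have "is_hyperplane (f x)" if "x \<in> P" for x
    unfolding is_hyperplane_def f_def using t0[OF that] by blast
  moreover have "contains_Krr r P Hs" if K: "contains_Krr r (g ` Hs) (f ` P)" for r
  proof -
    from K obtain A B where AB: "A \<subseteq> g ` Hs" "B \<subseteq> f ` P" "card A = r" "card B = r"
      "\<forall>p\<in>A. \<forall>H\<in>B. p \<in> H" by (rule contains_KrrE)
    obtain A' where A': "A' \<subseteq> Hs" "inj_on g A'" "A = g ` A'" using AB(1) by (meson subset_image_inj)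
    obtain B' where B': "B' \<subseteq> P" "inj_on f B'" "B = f ` B'" using AB(2) by (meson subset_image_inj)
    have "card A' = r" "card B' = r" using AB A' B' by (simp_all add: card_image)
    moreover have "\<forall>p\<in>B'. \<forall>H\<in>A'. p \<in> H" using AB(5) A' B' mem by blast
    ultimately show ?thesis unfolding contains_Krr_def using A' B' by blast
  qed
  moreover have "inc (g ` Hs) (f ` P) = inc P Hs"
  proof -
    have "{(p, H). p \<in> g ` Hs \<and> H \<in> f ` P \<and> p \<in> H} = (\<lambda>(x, H). (g H, f x)) ` {(x, H). x \<in> P \<and> H \<in> Hs \<and> x \<in> H}"
      using mem by force
    moreover have "inj_on (\<lambda>(x, H). (g H, f x)) {(x, H). x \<in> P \<and> H \<in> Hs \<and> x \<in> H}"
      using inj_f inj_g by (auto simp: inj_on_def)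
    ultimately show ?thesis unfolding inc_def by (simp add: card_image)
  qed
  ultimately show ?thesis using fin inj_f inj_g
    by (intro exI[of _ "g ` Hs"] exI[of _ "f ` P"]) (auto simp: card_image)
qed

text \<open>New points avoid all old hyperplanes, and the new hyperplanes, parallel to each other,
  avoid all points, so no incidence is created. A \<open>K_{r,r}\<close> with
  \<open>r \<ge> 1\<close> therefore lies in the old configuration.\<close>

lemma ex_padded_configuration:
  fixes P :: "(real ^ 'd) set"
  assumes fin: "finite P" "finite Hs" and hyp: "\<forall>H\<in>Hs. is_hyperplane H"
    and card: "card P \<le> n" "card Hs \<le> m" and r: "r \<ge> 1" "\<not> contains_Krr r P Hs"
  shows "\<exists>(P' :: (real ^ 'd) set) Hs'. finite P' \<and> card P' = n \<and> finite Hs' \<and> card Hs' = m \<and>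
    (\<forall>H\<in>Hs'. is_hyperplane H) \<and> \<not> contains_Krr r P' Hs' \<and> inc P Hs \<le> inc P' Hs'"
proof -
  obtain a b where ab: "\<And>H. H \<in> Hs \<Longrightarrow> a H \<noteq> 0" "\<And>H. H \<in> Hs \<Longrightarrow> H = {x. a H \<bullet> x = b H}"
    using hyperplanes_representation[OF hyp] by metis
  have "infinite {t. t \<notin> P \<and> (\<forall>H\<in>Hs. a H \<bullet> t \<noteq> b H)}"
    by (rule ex_generic_point) (use fin ab in auto)
  then obtain X where X: "finite X" "card X = n - card P" "X \<subseteq> {t. t \<notin> P \<and> (\<forall>H\<in>Hs. a H \<bullet> t \<noteq> b H)}"
    by (meson infinite_arbitrarily_large)
  have XH: "x \<notin> H" if "x \<in> X" "H \<in> Hs" for x H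
    using X(3) that by (subst ab(2)[OF that(2)]) auto
  define P' where "P' = P \<union> X"
  have "P \<inter> X = {}" using X(3) by blast
  hence P': "finite P'" "card P' = n"
    using fin X card by (simp_all add: P'_def card_Un_disjoint)
  define i :: 'd where "i = undefined"
  define h where "h = (\<lambda>c. {x :: real ^ 'd. axis i 1 \<bullet> x = c})"
  have mem_h: "x \<in> h c \<longleftrightarrow> x $ i = c" for x c by (simp add: h_def inner_axis')
  have "inj h"
  proof (rule injI)
    fix c c' assume "h c = h c'"
    moreover have "axis i c \<in> h c" by (simp add: mem_h)
    ultimately show "c = c'" by (simp add: mem_h)
  qed
  moreover have "infinite (UNIV - (\<lambda>x. x $ i) ` P')" using P' by (simp add: infinite_UNIV_char_0)
  ultimately have "infinite (h ` (UNIV - (\<lambda>x. x $ i) ` P'))"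
    by (metis finite_imageD inj_on_subset subset_UNIV)
  hence "infinite (h ` (UNIV - (\<lambda>x. x $ i) ` P') - Hs)" using fin by simp
  then obtain Y where Y: "finite Y" "card Y = m - card Hs" "Y \<subseteq> h ` (UNIV - (\<lambda>x. x $ i) ` P') - Hs"
    by (meson infinite_arbitrarily_large)
  have YP: "x \<notin> H" if x: "x \<in> P'" and H: "H \<in> Y" for x H
  proof -
    obtain c where "H = h c" "c \<notin> (\<lambda>x. x $ i) ` P'" using Y(3) H by blast
    thus ?thesis using x by (auto simp: mem_h)
  qed
  define Hs' where "Hs' = Hs \<union> Y"
  have "Hs \<inter> Y = {}" using Y(3) by blast
  hence Hs': "finite Hs'" "card Hs' = m"
    using fin Y card by (simp_all add: Hs'_def card_Un_disjoint)
  have "is_hyperplane (h c)" for c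
    unfolding is_hyperplane_def h_def by (intro exI[of _ "axis i 1"] exI[of _ c]) (simp add: axis_eq_0_iff)
  hence hyp': "\<forall>H\<in>Hs'. is_hyperplane H" using hyp Y(3) by (auto simp: Hs'_def)
  have old: "x \<in> P \<and> H \<in> Hs" if x: "x \<in> P'" and H: "H \<in> Hs'" and xH: "x \<in> H" for x H
  proof -
    have "H \<notin> Y" using YP[OF x] xH by blast
    hence "H \<in> Hs" using H by (simp add: Hs'_def)
    moreover have "x \<notin> X" using XH[OF _ \<open>H \<in> Hs\<close>] xH by blast
    hence "x \<in> P" using x by (simp add: P'_def)
    ultimately show ?thesis by blast
  qed
  have "\<not> contains_Krr r P' Hs'"
  proof
    assume "contains_Krr r P' Hs'"
    then obtain A B where AB: "A \<subseteq> P'" "B \<subseteq> Hs'" "card A = r" "card B = r"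
      "\<forall>p\<in>A. \<forall>H\<in>B. p \<in> H" by (rule contains_KrrE)
    have "A \<noteq> {}" "B \<noteq> {}" using AB r by auto
    hence "A \<subseteq> P" "B \<subseteq> Hs" using AB old by blast+
    hence "contains_Krr r P Hs" using AB unfolding contains_Krr_def by blast
    thus False using r by blast
  qed
  moreover have "inc P Hs \<le> inc P' Hs'"
    unfolding inc_def
  proof (rule card_mono)
    show "finite {(p, H). p \<in> P' \<and> H \<in> Hs' \<and> p \<in> H}"
      by (rule finite_subset[of _ "P' \<times> Hs'"]) (use P' Hs' in auto)
  qed (auto simp: P'_def Hs'_def)
  ultimately show ?thesis using P' Hs' hyp' by blast
qed

section \<open>Choice of the dimensions and assembly\<close>

text \<open>The inequality, needed for \<open>balanced_powr_le\<close>, amounts to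
  \<open>K * (2 * d - 1) \<le> d ^ 2 - 1\<close>, and \<open>K = d div 2\<close> is its largest
  solution. This rounding is why the exponent depends on the parity of \<open>d\<close>.\<close>

lemma ex_balancing_dimensions:
  assumes "d \<ge> 2"
  obtains K s :: nat where "0 < K" "0 < s" "K + s = d"
    "real K / (real K + 1 - 1 / real d) \<le> 1 - real K / (real (s + 1) * (real K + 1 - 1 / real d))"
    "inc_exponent d = (1 - real K / (real (s + 1) * (real K + 1 - 1 / real d)) + real K / (real K + 1 - 1 / real d)) / 2"
proof (cases "odd d")
  case True
  then obtain k where k: "d = 2 * k + 1" by (elim oddE)
  have k1: "real k \<ge> 1" using assms k by simp
  have \<beta>: "real k + 1 - 1 / real d = real k * (2 * real k + 3) / (2 * real k + 1)"
    unfolding k using k1 by (simp add: field_simps)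
  have q: "real k / (real k + 1 - 1 / real d) = (2 * real k + 1) / (2 * real k + 3)"
    unfolding \<beta> using k1 by simp
  have q': "real k / (real (k + 1 + 1) * (real k + 1 - 1 / real d)) = (2 * real k + 1) / (2 * real k + 3) / (real k + 2)"
    unfolding q[symmetric] by (simp add: mult.commute)
  show ?thesis
  proof (rule that[of k "k + 1"])
    show "real k / (real k + 1 - 1 / real d) \<le> 1 - real k / (real (k + 1 + 1) * (real k + 1 - 1 / real d))"
      unfolding q q' using k1 by (simp add: divide_simps) (simp add: algebra_simps)
    show "inc_exponent d = (1 - real k / (real (k + 1 + 1) * (real k + 1 - 1 / real d)) + real k / (real k + 1 - 1 / real d)) / 2"
      unfolding q q' inc_exponent_def using True k k1 by (simp add: divide_simps) (simp add: algebra_simps)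
  qed (use k k1 in auto)
next
  case False
  hence "even d" by simp
  then obtain k where k: "d = 2 * k" by (elim evenE)
  have k1: "real k \<ge> 1" using assms k by simp
  define D where "D = 2 * (real k)\<^sup>2 + 2 * real k - 1"
  have D: "D > 0" unfolding D_def using k1 zero_le_power2[of "real k"] by linarith
  have \<beta>: "real k + 1 - 1 / real d = D / (2 * real k)"
    unfolding k D_def using k1 by (simp add: field_simps power2_eq_square)
  have q: "real k / (real k + 1 - 1 / real d) = 2 * (real k)\<^sup>2 / D"
    unfolding \<beta> by (simp add: power2_eq_square)
  have q': "real k / (real (k + 1) * (real k + 1 - 1 / real d)) = 2 * (real k)\<^sup>2 / D / (real k + 1)"
    unfolding q[symmetric] by (simp add: mult.commute)
  show ?thesis
  proof (rule that[of k k])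
    show "real k / (real k + 1 - 1 / real d) \<le> 1 - real k / (real (k + 1) * (real k + 1 - 1 / real d))"
      unfolding q q' using k1 D by (simp add: divide_simps) (simp add: D_def power2_eq_square algebra_simps)
    have d2: "(real d)\<^sup>2 + 2 * real d - 2 = 2 * D" by (simp add: k D_def power2_eq_square)
    have "inc_exponent d = 1 - (8 * (real k)\<^sup>2 + 2 * real k - 2) / ((2 * real k + 2) * (2 * D))"
      unfolding inc_exponent_def d2 using False by (simp add: k power2_eq_square)
    also have "\<dots> = (1 - 2 * (real k)\<^sup>2 / D / (real k + 1) + 2 * (real k)\<^sup>2 / D) / 2"
      using k1 D by (simp add: divide_simps) (simp add: D_def power2_eq_square algebra_simps)
    finally show "inc_exponent d = (1 - real k / (real (k + 1) * (real k + 1 - 1 / real d)) + real k / (real k + 1 - 1 / real d)) / 2"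
      unfolding q q' .
  qed (use k k1 in auto)
qed

theorem theorem6:
  fixes \<epsilon> :: real
  assumes "CARD('d::finite) \<ge> 2"
    and "0 < \<epsilon>" and "\<epsilon> < 1"
  shows "\<exists>(r::nat) (c::real). c > 0 \<and>
    (\<forall>n m :: nat. n \<ge> 1 \<longrightarrow> m \<ge> 1 \<longrightarrow>
      (\<exists>(P :: (real ^ 'd) set) (Hs :: (real ^ 'd) set set).
         finite P \<and> card P = n \<and> finite Hs \<and> card Hs = m \<and>
         (\<forall>H\<in>Hs. is_hyperplane H) \<and>
         \<not> contains_Krr r P Hs \<and>
         real (inc P Hs) \<ge> c * (real m * real n) powr (inc_exponent CARD('d) - \<epsilon>)))"
proof -
  let ?E = "inc_exponent CARD('d) - \<epsilon>"
  obtain K s where Ks: "0 < K" "0 < s" "K + s = CARD('d)"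
    "real K / (real K + 1 - 1 / real CARD('d)) \<le> 1 - real K / (real (s + 1) * (real K + 1 - 1 / real CARD('d)))"
    and E: "inc_exponent CARD('d) = (1 - real K / (real (s + 1) * (real K + 1 - 1 / real CARD('d))) +
      real K / (real K + 1 - 1 / real CARD('d))) / 2"
    using ex_balancing_dimensions[OF assms(1)] by blast
  obtain r c where r: "r \<ge> 1" and c: "c > 0" and conf: "\<And>n m. 1 \<le> m \<Longrightarrow> m \<le> n \<Longrightarrow>
    \<exists>(P :: (real ^ 'd) set) Hs. finite P \<and> card P \<le> n \<and> finite Hs \<and> card Hs \<le> m \<and>
       (\<forall>H\<in>Hs. is_hyperplane H) \<and> \<not> contains_Krr r P Hs \<and>
       c * (real m * real n) powr ?E \<le> real (inc P Hs)"
    using ex_unbalanced_configuration[OF Ks(1-3) assms(2,3) Ks(4)] unfolding E by metis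
  show ?thesis
  proof (intro exI[of _ r] exI[of _ c] conjI c allI impI)
    fix n m :: nat assume nm: "n \<ge> 1" "m \<ge> 1"
    obtain P :: "(real ^ 'd) set" and Hs where PH: "finite P" "card P \<le> n" "finite Hs" "card Hs \<le> m"
      "\<forall>H\<in>Hs. is_hyperplane H" "\<not> contains_Krr r P Hs" "c * (real m * real n) powr ?E \<le> real (inc P Hs)"
    proof (cases "m \<le> n")
      case True
      thus ?thesis using conf[OF nm(2) True] that by blast
    next
      \<comment> \<open>A configuration with at most \<open>m\<close> points and \<open>n\<close>
        hyperplanes is built and dualised; the bound is symmetric in \<open>m\<close> and
        \<open>n\<close>.\<close>
      case False
      hence "n \<le> m" by simp
      then obtain P :: "(real ^ 'd) set" and Hs where PH: "finite P" "card P \<le> m" "finite Hs" "card Hs \<le> n"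
        "\<forall>H\<in>Hs. is_hyperplane H" "\<not> contains_Krr r P Hs" "c * (real n * real m) powr ?E \<le> real (inc P Hs)"
        using conf[OF nm(1)] by blast
      obtain P' :: "(real ^ 'd) set" and Hs' where "finite P'" "card P' = card Hs" "finite Hs'" "card Hs' = card P"
        "\<forall>H\<in>Hs'. is_hyperplane H" "\<forall>r. contains_Krr r P' Hs' \<longrightarrow> contains_Krr r P Hs" "inc P' Hs' = inc P Hs"
        using ex_dual_configuration[OF PH(1,3,5)] by blast
      thus ?thesis using PH by (intro that[of P' Hs']) (auto simp: mult.commute)
    qed
    obtain P' :: "(real ^ 'd) set" and Hs' where P': "finite P'" "card P' = n" "finite Hs'" "card Hs' = m"
      "\<forall>H\<in>Hs'. is_hyperplane H" "\<not> contains_Krr r P' Hs'" "inc P Hs \<le> inc P' Hs'"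
      using ex_padded_configuration[OF PH(1,3,5,2,4) r PH(6)] by blast
    have "c * (real m * real n) powr ?E \<le> real (inc P' Hs')"
      using PH(7) P'(7) by linarith
    with P' show "\<exists>(P :: (real ^ 'd) set) (Hs :: (real ^ 'd) set set).
         finite P \<and> card P = n \<and> finite Hs \<and> card Hs = m \<and> (\<forall>H\<in>Hs. is_hyperplane H) \<and>
         \<not> contains_Krr r P Hs \<and> real (inc P Hs) \<ge> c * (real m * real n) powr ?E"
      by blast
  qed
qed

end
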